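(* Let $(T^\bullet,\delta^\bullet):\mathcal C\to\mathcal D$ be a cohomological functor and let $f:A\to B$ be a morphism in $\mathcal C$. Then for any $n\in\mathbb Z$ the squares (for $k\in\mathbb N_0$) expressing $$S^{-k}\underline\delta^{n+k}(B)\circ S^{-k}T^{n+k}(f)=S^{-k-1}T^{n+k+1}(f)\circ S^{-k}\underline\delta^{n+k}(A):\ S^{-k}T^{n+k}(A)\to S^{-k-1}T^{n+k+1}(B)$$ commute and give rise to $$\widehat T^n(f)=\varinjlim_{k\in\mathbb N_0}S^{-k}T^{n+k}(f):\ \widehat T^n(A)\to\widehat T^n(B),$$ the induced morphism in the satellite functor construction $\widehat T^\bullet$.
   Context: Standing assumptions: $\mathcal C$ is an abelian category with enough projectives; $\mathcal D$ is an abelian category in which all direct limits (colimits over directed sets) exist and are exact. A cohomological functor $(T^\bullet,\delta^\bullet):\mathcal C\to\mathcal D$ is a family of additive functors $(T^n)_{n\in\mathbb Z}$ with, for each short exact sequence $0\to A\to B\to C\to0$, connecting homomorphisms $\delta^n:T^n(C)\to T^{n+1}(A)$, natural in the sequence, giving a long exact sequence. Morphisms are families of natural transformations commuting with connecting homomorphisms. Left satellites: for an additive functor $F:\mathcal C\to\mathcal D$ and $M\in\mathcal C$ choose $0\to K\to P\to M\to0$ exact with $P$ projective and put $S^{-1}F(M)=\mathrm{Ker}(F(K)\to F(P))$ (independent of choices up to canonical isomorphism); morphisms $M'\to M$ act via lifts $P'\to P$ and the induced $K'\to K$. $S^0F=F$, $S^{-k}F=S^{-1}(S^{-k+1}F)$.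 For a natural transformation $\varphi:F\to G$, $S^{-1}\varphi(M)$ is the restriction of $\varphi(K)$ to the kernels, $S^0\varphi=\varphi$ and $S^{-k}\varphi=S^{-1}(S^{-k+1}\varphi)$. For $0\to A\to B\to C\to0$ exact and $k\ge0$, $\varepsilon^{-k-1}:S^{-k-1}F(C)\to S^{-k}F(A)$ is the composite of the kernel inclusion $S^{-k-1}F(C)\to S^{-k}F(K)$ with $S^{-k}F(h^* )$, where $0\to K\to P\to C\to0$ is exact with $P$ projective, $h:P\to B$ lifts $\mathrm{id}_C$, and $h^*:K\to A$ is induced by $h$. For $0\to K\to P\to M\to0$ exact with $P$ projective, $\delta^n:T^n(M)\to T^{n+1}(K)$ factors as $T^n(M)\xrightarrow{\underline\delta^n}S^{-1}T^{n+1}(M)\hookrightarrow T^{n+1}(K)$; this defines the natural transformation $\underline\delta^n:T^n\to S^{-1}T^{n+1}$. Satellite functor construction: for $m\in\mathbb N_0$ let $T^\bullet\langle m\rangle$ be the cohomological functor with $T^k\langle m\rangle=T^k$ for $k\ge m$, $T^k\langle m\rangle=S^{k-m}T^m$ for $k<m$, and connecting homomorphisms $\delta^k$ for $k\ge m$, $\varepsilon^{k-m}$ for $k<m$. For $m\le m'$ let $\Phi^\bullet_{m,m'}:T^\bullet\langle m\rangle\to T^\bullet\langle m'\rangle$ be the unique morphism of cohomological functors that is the identity in degrees $\ge m'$. Then $\widehat T^\bullet=\varinjlim_{m\in\mathbb N_0}T^\bullet\langle m\rangle$ as functors; by cofinality $\widehat T^n(M)=\varinjlim_{k\in\mathbb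 N_0}S^{-k}T^{n+k}(M)$ (indices $k$ large enough that $n+k\ge0$). *)

theory Defs
  imports "HOL-Algebra.Group"
begin

section \<open>Abelian categories\<close>

text \<open>
  A category is given by a set of objects and a set of arrows with domain and codomain. The last
  two fields carry the additive structure: addition of parallel arrows, and the zero arrow
  from \<open>A\<close> to \<open>B\<close>. The values of all operations outside of these sets are irrelevant.
\<close>

record ('o, 'a) cat =
  Ob :: "'o set"
  Ar :: "'a set"
  Dom :: "'a \<Rightarrow> 'o"
  Cod :: "'a \<Rightarrow> 'o"
  Idn :: "'o \<Rightarrow> 'a"
  Cmp :: "'a \<Rightarrow> 'a \<Rightarrow> 'a" (infixl "\<cdot>\<index>" 70)
  Add :: "'a \<Rightarrow> 'a \<Rightarrow> 'a"
  Zer :: "'o \<Rightarrow> 'o \<Rightarrow> 'a"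

definition Hom :: "('o, 'a) cat \<Rightarrow> 'o \<Rightarrow> 'o \<Rightarrow> 'a set" where
  "Hom C A B = {f \<in> Ar C. Dom C f = A \<and> Cod C f = B}"

definition hom_group :: "('o, 'a) cat \<Rightarrow> 'o \<Rightarrow> 'o \<Rightarrow> 'a monoid" where
  "hom_group C A B = \<lparr>carrier = Hom C A B, mult = Add C, one = Zer C A B\<rparr>"

locale category =
  fixes C :: "('o, 'a) cat"
  assumes Dom_Ob: "f \<in> Ar C \<Longrightarrow> Dom C f \<in> Ob C"
    and Cod_Ob: "f \<in> Ar C \<Longrightarrow> Cod C f \<in> Ob C"
    and Idn_Hom: "A \<in> Ob C \<Longrightarrow> Idn C A \<in> Hom C A A"
    and Cmp_Hom: "f \<in> Hom C A B \<Longrightarrow> g \<in> Hom C B E \<Longrightarrow> g \<cdot>\<^bsub>C\<^esub> f \<in> Hom C A E"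
    and Cmp_assoc: "f \<in> Hom C A B \<Longrightarrow> g \<in> Hom C B E \<Longrightarrow> h \<in> Hom C E G \<Longrightarrow>
      (h \<cdot>\<^bsub>C\<^esub> g) \<cdot>\<^bsub>C\<^esub> f = h \<cdot>\<^bsub>C\<^esub> (g \<cdot>\<^bsub>C\<^esub> f)"
    and Cmp_Idn: "f \<in> Hom C A B \<Longrightarrow> f \<cdot>\<^bsub>C\<^esub> Idn C A = f"
    and Idn_Cmp: "f \<in> Hom C A B \<Longrightarrow> Idn C B \<cdot>\<^bsub>C\<^esub> f = f"

locale preadditive_category = category C for C :: "('o, 'a) cat" +
  assumes hom_comm_group: "A \<in> Ob C \<Longrightarrow> B \<in> Ob C \<Longrightarrow> comm_group (hom_group C A B)"
    and Cmp_Add: "f \<in> Hom C A B \<Longrightarrow> g \<in> Hom C A B \<Longrightarrow> h \<in> Hom C B E \<Longrightarrow>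
      h \<cdot>\<^bsub>C\<^esub> (Add C f g) = Add C (h \<cdot>\<^bsub>C\<^esub> f) (h \<cdot>\<^bsub>C\<^esub> g)"
    and Add_Cmp: "f \<in> Hom C A B \<Longrightarrow> g \<in> Hom C B E \<Longrightarrow> h \<in> Hom C B E \<Longrightarrow>
      (Add C g h) \<cdot>\<^bsub>C\<^esub> f = Add C (g \<cdot>\<^bsub>C\<^esub> f) (h \<cdot>\<^bsub>C\<^esub> f)"

definition zero_object :: "('o, 'a) cat \<Rightarrow> 'o \<Rightarrow> bool" where
  "zero_object C Z \<longleftrightarrow> Z \<in> Ob C \<and>
     (\<forall>A\<in>Ob C. (\<exists>!f. f \<in> Hom C Z A) \<and> (\<exists>!f. f \<in> Hom C A Z))"

definition biproduct :: "('o, 'a) cat \<Rightarrow> 'o \<Rightarrow> 'o \<Rightarrow> 'o \<Rightarrow> bool" where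
  "biproduct C A B S \<longleftrightarrow> S \<in> Ob C \<and>
     (\<exists>i\<in>Hom C A S. \<exists>j\<in>Hom C B S. \<exists>p\<in>Hom C S A. \<exists>q\<in>Hom C S B.
        p \<cdot>\<^bsub>C\<^esub> i = Idn C A \<and> q \<cdot>\<^bsub>C\<^esub> j = Idn C B \<and>
        p \<cdot>\<^bsub>C\<^esub> j = Zer C B A \<and> q \<cdot>\<^bsub>C\<^esub> i = Zer C A B \<and>
        Add C (i \<cdot>\<^bsub>C\<^esub> p) (j \<cdot>\<^bsub>C\<^esub> q) = Idn C S)"

definition is_kernel :: "('o, 'a) cat \<Rightarrow> 'a \<Rightarrow> 'a \<Rightarrow> bool" where
  "is_kernel C k g \<longleftrightarrow> k \<in> Ar C \<and> g \<in> Ar C \<and> Cod C k = Dom C g \<and>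
     g \<cdot>\<^bsub>C\<^esub> k = Zer C (Dom C k) (Cod C g) \<and>
     (\<forall>h\<in>Ar C. Cod C h = Dom C g \<and> g \<cdot>\<^bsub>C\<^esub> h = Zer C (Dom C h) (Cod C g) \<longrightarrow>
        (\<exists>!u. u \<in> Hom C (Dom C h) (Dom C k) \<and> k \<cdot>\<^bsub>C\<^esub> u = h))"

definition is_cokernel :: "('o, 'a) cat \<Rightarrow> 'a \<Rightarrow> 'a \<Rightarrow> bool" where
  "is_cokernel C c g \<longleftrightarrow> c \<in> Ar C \<and> g \<in> Ar C \<and> Dom C c = Cod C g \<and>
     c \<cdot>\<^bsub>C\<^esub> g = Zer C (Dom C g) (Cod C c) \<and>
     (\<forall>h\<in>Ar C. Dom C h = Cod C g \<and> h \<cdot>\<^bsub>C\<^esub> g = Zer C (Dom C g) (Cod C h) \<longrightarrow>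
        (\<exists>!u. u \<in> Hom C (Cod C c) (Cod C h) \<and> u \<cdot>\<^bsub>C\<^esub> c = h))"

definition is_mono :: "('o, 'a) cat \<Rightarrow> 'a \<Rightarrow> bool" where
  "is_mono C f \<longleftrightarrow> f \<in> Ar C \<and>
     (\<forall>A. \<forall>g\<in>Hom C A (Dom C f). \<forall>h\<in>Hom C A (Dom C f). f \<cdot>\<^bsub>C\<^esub> g = f \<cdot>\<^bsub>C\<^esub> h \<longrightarrow> g = h)"

definition is_epi :: "('o, 'a) cat \<Rightarrow> 'a \<Rightarrow> bool" where
  "is_epi C f \<longleftrightarrow> f \<in> Ar C \<and>
     (\<forall>A. \<forall>g\<in>Hom C (Cod C f) A. \<forall>h\<in>Hom C (Cod C f) A. g \<cdot>\<^bsub>C\<^esub> f = h \<cdot>\<^bsub>C\<^esub> f \<longrightarrow> g = h)"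

locale abelian_category = preadditive_category C for C :: "('o, 'a) cat" +
  assumes ex_zero_object: "\<exists>Z. zero_object C Z"
    and ex_biproduct: "A \<in> Ob C \<Longrightarrow> B \<in> Ob C \<Longrightarrow> \<exists>S. biproduct C A B S"
    and ex_kernel: "f \<in> Ar C \<Longrightarrow> \<exists>k. is_kernel C k f"
    and ex_cokernel: "f \<in> Ar C \<Longrightarrow> \<exists>c. is_cokernel C c f"
    and mono_is_kernel: "is_mono C f \<Longrightarrow> \<exists>g. is_kernel C f g"
    and epi_is_cokernel: "is_epi C f \<Longrightarrow> \<exists>g. is_cokernel C f g"

text \<open>
  Exactness of \<open>f: A \<rightarrow> B\<close>, \<open>g: B \<rightarrow> E\<close> at \<open>B\<close>: the image of \<open>f\<close>, that is the kernel \<open>i\<close> of its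
  cokernel \<open>c\<close>, is a kernel of \<open>g\<close>.
\<close>

definition exact_pair :: "('o, 'a) cat \<Rightarrow> 'a \<Rightarrow> 'a \<Rightarrow> bool" where
  "exact_pair C f g \<longleftrightarrow> (\<exists>c i. is_cokernel C c f \<and> is_kernel C i c \<and> is_kernel C i g)"

definition short_exact :: "('o, 'a) cat \<Rightarrow> 'a \<Rightarrow> 'a \<Rightarrow> bool" where
  "short_exact C i p \<longleftrightarrow> is_kernel C i p \<and> is_cokernel C p i"

definition projective :: "('o, 'a) cat \<Rightarrow> 'o \<Rightarrow> bool" where
  "projective C P \<longleftrightarrow> P \<in> Ob C \<and>
     (\<forall>e g. is_epi C e \<and> g \<in> Hom C P (Cod C e) \<longrightarrow> (\<exists>h\<in>Hom C P (Dom C e). e \<cdot>\<^bsub>C\<^esub> h = g))"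

definition enough_projectives :: "('o, 'a) cat \<Rightarrow> bool" where
  "enough_projectives C \<longleftrightarrow>
     (\<forall>M\<in>Ob C. \<exists>P p. projective C P \<and> p \<in> Hom C P M \<and> is_epi C p)"


section \<open>Direct limits\<close>

definition directed_set :: "'i set \<Rightarrow> ('i \<Rightarrow> 'i \<Rightarrow> bool) \<Rightarrow> bool" where
  "directed_set I rel \<longleftrightarrow> I \<noteq> {} \<and> (\<forall>i\<in>I. rel i i) \<and>
     (\<forall>i\<in>I. \<forall>j\<in>I. \<forall>k\<in>I. rel i j \<and> rel j k \<longrightarrow> rel i k) \<and>
     (\<forall>i\<in>I. \<forall>j\<in>I. \<exists>k\<in>I. rel i k \<and> rel j k)"

definition direct_system ::
  "('o, 'a) cat \<Rightarrow> 'i set \<Rightarrow> ('i \<Rightarrow> 'i \<Rightarrow> bool) \<Rightarrow> ('i \<Rightarrow> 'o) \<Rightarrow> ('i \<Rightarrow> 'i \<Rightarrow> 'a) \<Rightarrow> bool" where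
  "direct_system C I rel ob tr \<longleftrightarrow>
     (\<forall>i\<in>I. ob i \<in> Ob C) \<and>
     (\<forall>i\<in>I. \<forall>j\<in>I. rel i j \<longrightarrow> tr i j \<in> Hom C (ob i) (ob j)) \<and>
     (\<forall>i\<in>I. tr i i = Idn C (ob i)) \<and>
     (\<forall>i\<in>I. \<forall>j\<in>I. \<forall>k\<in>I. rel i j \<and> rel j k \<longrightarrow> tr j k \<cdot>\<^bsub>C\<^esub> tr i j = tr i k)"

definition cocone ::
  "('o, 'a) cat \<Rightarrow> 'i set \<Rightarrow> ('i \<Rightarrow> 'i \<Rightarrow> bool) \<Rightarrow> ('i \<Rightarrow> 'o) \<Rightarrow> ('i \<Rightarrow> 'i \<Rightarrow> 'a) \<Rightarrow>
   'o \<Rightarrow> ('i \<Rightarrow> 'a) \<Rightarrow> bool" where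
  "cocone C I rel ob tr Y g \<longleftrightarrow> Y \<in> Ob C \<and> (\<forall>i\<in>I. g i \<in> Hom C (ob i) Y) \<and>
     (\<forall>i\<in>I. \<forall>j\<in>I. rel i j \<longrightarrow> g j \<cdot>\<^bsub>C\<^esub> tr i j = g i)"

definition is_direct_limit ::
  "('o, 'a) cat \<Rightarrow> 'i set \<Rightarrow> ('i \<Rightarrow> 'i \<Rightarrow> bool) \<Rightarrow> ('i \<Rightarrow> 'o) \<Rightarrow> ('i \<Rightarrow> 'i \<Rightarrow> 'a) \<Rightarrow>
   'o \<Rightarrow> ('i \<Rightarrow> 'a) \<Rightarrow> bool" where
  "is_direct_limit C I rel ob tr L leg \<longleftrightarrow>
     direct_system C I rel ob tr \<and> cocone C I rel ob tr L leg \<and>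
     (\<forall>Y g. cocone C I rel ob tr Y g \<longrightarrow>
        (\<exists>!w. w \<in> Hom C L Y \<and> (\<forall>i\<in>I. w \<cdot>\<^bsub>C\<^esub> leg i = g i)))"

definition direct_system_map ::
  "('o, 'a) cat \<Rightarrow> 'i set \<Rightarrow> ('i \<Rightarrow> 'i \<Rightarrow> bool) \<Rightarrow> ('i \<Rightarrow> 'o) \<Rightarrow> ('i \<Rightarrow> 'i \<Rightarrow> 'a) \<Rightarrow>
   ('i \<Rightarrow> 'o) \<Rightarrow> ('i \<Rightarrow> 'i \<Rightarrow> 'a) \<Rightarrow> ('i \<Rightarrow> 'a) \<Rightarrow> bool" where
  "direct_system_map C I rel ob tr ob' tr' u \<longleftrightarrow>
     (\<forall>i\<in>I. u i \<in> Hom C (ob i) (ob' i)) \<and>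
     (\<forall>i\<in>I. \<forall>j\<in>I. rel i j \<longrightarrow> u j \<cdot>\<^bsub>C\<^esub> tr i j = tr' i j \<cdot>\<^bsub>C\<^esub> u i)"

text \<open>
  \<open>w: L \<rightarrow> L'\<close> is the direct limit of the family of arrows \<open>u\<close>, where \<open>L\<close> and \<open>L'\<close> are direct
  limits with structure maps \<open>leg\<close> and \<open>leg'\<close>.
\<close>

definition is_direct_limit_map ::
  "('o, 'a) cat \<Rightarrow> 'i set \<Rightarrow> 'o \<Rightarrow> ('i \<Rightarrow> 'a) \<Rightarrow> 'o \<Rightarrow> ('i \<Rightarrow> 'a) \<Rightarrow> ('i \<Rightarrow> 'a) \<Rightarrow> 'a \<Rightarrow> bool" where
  "is_direct_limit_map C I L leg L' leg' u w \<longleftrightarrow>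
     w \<in> Hom C L L' \<and> (\<forall>i\<in>I. w \<cdot>\<^bsub>C\<^esub> leg i = leg' i \<cdot>\<^bsub>C\<^esub> u i) \<and>
     (\<forall>w'\<in>Hom C L L'. (\<forall>i\<in>I. w' \<cdot>\<^bsub>C\<^esub> leg i = leg' i \<cdot>\<^bsub>C\<^esub> u i) \<longrightarrow> w' = w)"

text \<open>
  All direct limits over directed sets exist and are exact. Since one cannot quantify over all
  types inside a formula, the (small) directed sets are the subsets of an index type \<open>'i\<close>, which
  plays the role of the universe of small sets.
\<close>

definition has_exact_direct_limits :: "'i itself \<Rightarrow> ('o, 'a) cat \<Rightarrow> bool" where
  "has_exact_direct_limits (ty :: 'i itself) C \<longleftrightarrow>
     (\<forall>(I :: 'i set) rel. directed_set I rel \<longrightarrow>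
        (\<forall>ob tr. direct_system C I rel ob tr \<longrightarrow> (\<exists>L leg. is_direct_limit C I rel ob tr L leg)) \<and>
        (\<forall>ob1 tr1 L1 leg1 ob2 tr2 L2 leg2 ob3 tr3 L3 leg3 u v u' v'.
           is_direct_limit C I rel ob1 tr1 L1 leg1 \<and>
           is_direct_limit C I rel ob2 tr2 L2 leg2 \<and>
           is_direct_limit C I rel ob3 tr3 L3 leg3 \<and>
           direct_system_map C I rel ob1 tr1 ob2 tr2 u \<and>
           direct_system_map C I rel ob2 tr2 ob3 tr3 v \<and>
           (\<forall>i\<in>I. short_exact C (u i) (v i)) \<and>
           is_direct_limit_map C I L1 leg1 L2 leg2 u u' \<and>
           is_direct_limit_map C I L2 leg2 L3 leg3 v v' \<longrightarrow>
           short_exact C u' v'))"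


section \<open>Cohomological functors\<close>

record ('oc, 'ac, 'od, 'ad) ftor =
  Obm :: "'oc \<Rightarrow> 'od"
  Arm :: "'ac \<Rightarrow> 'ad"

definition additive_functor ::
  "('oc, 'ac) cat \<Rightarrow> ('od, 'ad) cat \<Rightarrow> ('oc, 'ac, 'od, 'ad) ftor \<Rightarrow> bool" where
  "additive_functor C D F \<longleftrightarrow>
     (\<forall>A\<in>Ob C. Obm F A \<in> Ob D) \<and>
     (\<forall>A B. \<forall>f\<in>Hom C A B. Arm F f \<in> Hom D (Obm F A) (Obm F B)) \<and>
     (\<forall>A\<in>Ob C. Arm F (Idn C A) = Idn D (Obm F A)) \<and>
     (\<forall>A B E. \<forall>f\<in>Hom C A B. \<forall>g\<in>Hom C B E. Arm F (g \<cdot>\<^bsub>C\<^esub> f) = Arm F g \<cdot>\<^bsub>D\<^esub> Arm F f) \<and>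
     (\<forall>A B. \<forall>f\<in>Hom C A B. \<forall>g\<in>Hom C A B. Arm F (Add C f g) = Add D (Arm F f) (Arm F g))"

definition nat_trans ::
  "('oc, 'ac) cat \<Rightarrow> ('od, 'ad) cat \<Rightarrow> ('oc, 'ac, 'od, 'ad) ftor \<Rightarrow> ('oc, 'ac, 'od, 'ad) ftor \<Rightarrow>
   ('oc \<Rightarrow> 'ad) \<Rightarrow> bool" where
  "nat_trans C D F G \<phi> \<longleftrightarrow>
     (\<forall>A\<in>Ob C. \<phi> A \<in> Hom D (Obm F A) (Obm G A)) \<and>
     (\<forall>A B. \<forall>f\<in>Hom C A B. \<phi> B \<cdot>\<^bsub>D\<^esub> Arm F f = Arm G f \<cdot>\<^bsub>D\<^esub> \<phi> A)"

text \<open>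
  \<open>Con T n i p\<close> is the connecting homomorphism in degree \<open>n\<close> of the short exact sequence with
  arrows \<open>i: A \<rightarrow> B\<close> and \<open>p: B \<rightarrow> E\<close>; it goes from \<open>T\<^sup>n(E)\<close> to \<open>T\<^sup>n\<^sup>+\<^sup>1(A)\<close>.
\<close>

record ('oc, 'ac, 'od, 'ad) cohf =
  Deg :: "int \<Rightarrow> ('oc, 'ac, 'od, 'ad) ftor"
  Con :: "int \<Rightarrow> 'ac \<Rightarrow> 'ac \<Rightarrow> 'ad"

definition cohomological_functor ::
  "('oc, 'ac) cat \<Rightarrow> ('od, 'ad) cat \<Rightarrow> ('oc, 'ac, 'od, 'ad) cohf \<Rightarrow> bool" where
  "cohomological_functor C D T \<longleftrightarrow>
     (\<forall>n. additive_functor C D (Deg T n)) \<and>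
     (\<forall>n i p. short_exact C i p \<longrightarrow>
        Con T n i p \<in> Hom D (Obm (Deg T n) (Cod C p)) (Obm (Deg T (n + 1)) (Dom C i))) \<and>
     (\<forall>n i p i' p' a b c.
        short_exact C i p \<and> short_exact C i' p' \<and>
        a \<in> Hom C (Dom C i) (Dom C i') \<and> b \<in> Hom C (Cod C i) (Cod C i') \<and>
        c \<in> Hom C (Cod C p) (Cod C p') \<and>
        b \<cdot>\<^bsub>C\<^esub> i = i' \<cdot>\<^bsub>C\<^esub> a \<and> c \<cdot>\<^bsub>C\<^esub> p = p' \<cdot>\<^bsub>C\<^esub> b \<longrightarrow>
        Arm (Deg T (n + 1)) a \<cdot>\<^bsub>D\<^esub> Con T n i p = Con T n i' p' \<cdot>\<^bsub>D\<^esub> Arm (Deg T n) c) \<and>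
     (\<forall>n i p. short_exact C i p \<longrightarrow>
        exact_pair D (Arm (Deg T n) i) (Arm (Deg T n) p) \<and>
        exact_pair D (Arm (Deg T n) p) (Con T n i p) \<and>
        exact_pair D (Con T n i p) (Arm (Deg T (n + 1)) i))"

definition cohf_morphism ::
  "('oc, 'ac) cat \<Rightarrow> ('od, 'ad) cat \<Rightarrow> ('oc, 'ac, 'od, 'ad) cohf \<Rightarrow> ('oc, 'ac, 'od, 'ad) cohf \<Rightarrow>
   (int \<Rightarrow> 'oc \<Rightarrow> 'ad) \<Rightarrow> bool" where
  "cohf_morphism C D T U \<Phi> \<longleftrightarrow>
     (\<forall>n. nat_trans C D (Deg T n) (Deg U n) (\<Phi> n)) \<and>
     (\<forall>n i p. short_exact C i p \<longrightarrow>
        \<Phi> (n + 1) (Dom C i) \<cdot>\<^bsub>D\<^esub> Con T n i p = Con U n i p \<cdot>\<^bsub>D\<^esub> \<Phi> n (Cod C p))"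


section \<open>Left satellites\<close>

text \<open>
  The choices entering the construction: for every object \<open>M\<close> of \<open>\<C>\<close> a short exact sequence
  \<open>0 \<rightarrow> K \<rightarrow> P \<rightarrow> M \<rightarrow> 0\<close> with \<open>P\<close> projective, given by its two arrows \<open>Pinc M\<close> and \<open>Pepi M\<close>; for
  every arrow of \<open>\<D>\<close> a kernel inclusion; and for every direct system in \<open>\<D>\<close> over the natural
  numbers a direct limit with its structure maps.
\<close>

record ('oc, 'ac, 'od, 'ad) choices =
  Pinc :: "'oc \<Rightarrow> 'ac"
  Pepi :: "'oc \<Rightarrow> 'ac"
  Ker :: "'ad \<Rightarrow> 'ad"
  Dlim :: "(nat \<Rightarrow> 'od) \<Rightarrow> (nat \<Rightarrow> nat \<Rightarrow> 'ad) \<Rightarrow> 'od \<times> (nat \<Rightarrow> 'ad)"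

definition satellite_choices ::
  "('oc, 'ac) cat \<Rightarrow> ('od, 'ad) cat \<Rightarrow> ('oc, 'ac, 'od, 'ad) choices \<Rightarrow> bool" where
  "satellite_choices C D X \<longleftrightarrow>
     (\<forall>M\<in>Ob C. short_exact C (Pinc X M) (Pepi X M) \<and> Cod C (Pepi X M) = M \<and>
        projective C (Dom C (Pepi X M))) \<and>
     (\<forall>g\<in>Ar D. is_kernel D (Ker X g) g) \<and>
     (\<forall>ob tr. direct_system D UNIV (\<le>) ob tr \<longrightarrow>
        is_direct_limit D UNIV (\<le>) ob tr (fst (Dlim X ob tr)) (snd (Dlim X ob tr)))"

definition syz :: "('oc, 'ac) cat \<Rightarrow> ('oc, 'ac, 'od, 'ad) choices \<Rightarrow> 'oc \<Rightarrow> 'oc" where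
  "syz C X M = Dom C (Pinc X M)"

text \<open>
  For a short exact sequence with arrows \<open>i: A \<rightarrow> B\<close>, \<open>p: B \<rightarrow> E\<close> and \<open>f: M \<rightarrow> E\<close>: a lift
  \<open>h: P \<rightarrow> B\<close> of \<open>f\<close>, where \<open>0 \<rightarrow> K \<rightarrow> P \<rightarrow> M \<rightarrow> 0\<close> is the chosen sequence of \<open>M\<close>, and the arrow
  \<open>K \<rightarrow> A\<close> induced by \<open>h\<close>.
\<close>

definition proj_lift ::
  "('oc, 'ac) cat \<Rightarrow> ('oc, 'ac, 'od, 'ad) choices \<Rightarrow> 'ac \<Rightarrow> 'ac \<Rightarrow> 'ac" where
  "proj_lift C X p f = (SOME h. h \<in> Hom C (Dom C (Pepi X (Dom C f))) (Dom C p) \<and>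
     p \<cdot>\<^bsub>C\<^esub> h = f \<cdot>\<^bsub>C\<^esub> Pepi X (Dom C f))"

definition syz_lift ::
  "('oc, 'ac) cat \<Rightarrow> ('oc, 'ac, 'od, 'ad) choices \<Rightarrow> 'ac \<Rightarrow> 'ac \<Rightarrow> 'ac \<Rightarrow> 'ac" where
  "syz_lift C X i p f = (THE u. u \<in> Hom C (syz C X (Dom C f)) (Dom C i) \<and>
     i \<cdot>\<^bsub>C\<^esub> u = proj_lift C X p f \<cdot>\<^bsub>C\<^esub> Pinc X (Dom C f))"

text \<open>The inclusion of \<open>S\<^sup>-\<^sup>1F(M) = Ker (F(K) \<rightarrow> F(P))\<close> into \<open>F(K)\<close>.\<close>

definition sat_inc ::
  "('oc, 'ac, 'od, 'ad) choices \<Rightarrow> ('oc, 'ac, 'od, 'ad) ftor \<Rightarrow> 'oc \<Rightarrow> 'ad" where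
  "sat_inc X F M = Ker X (Arm F (Pinc X M))"

definition sat_obj ::
  "('od, 'ad) cat \<Rightarrow> ('oc, 'ac, 'od, 'ad) choices \<Rightarrow> ('oc, 'ac, 'od, 'ad) ftor \<Rightarrow> 'oc \<Rightarrow> 'od" where
  "sat_obj D X F M = Dom D (sat_inc X F M)"

definition sat_arr ::
  "('oc, 'ac) cat \<Rightarrow> ('od, 'ad) cat \<Rightarrow> ('oc, 'ac, 'od, 'ad) choices \<Rightarrow>
   ('oc, 'ac, 'od, 'ad) ftor \<Rightarrow> 'ac \<Rightarrow> 'ad" where
  "sat_arr C D X F f =
     (THE u. u \<in> Hom D (sat_obj D X F (Dom C f)) (sat_obj D X F (Cod C f)) \<and>
        sat_inc X F (Cod C f) \<cdot>\<^bsub>D\<^esub> u =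
        Arm F (syz_lift C X (Pinc X (Cod C f)) (Pepi X (Cod C f)) f) \<cdot>\<^bsub>D\<^esub> sat_inc X F (Dom C f))"

definition sat ::
  "('oc, 'ac) cat \<Rightarrow> ('od, 'ad) cat \<Rightarrow> ('oc, 'ac, 'od, 'ad) choices \<Rightarrow>
   ('oc, 'ac, 'od, 'ad) ftor \<Rightarrow> ('oc, 'ac, 'od, 'ad) ftor" where
  "sat C D X F = \<lparr>Obm = sat_obj D X F, Arm = sat_arr C D X F\<rparr>"

text \<open>\<open>sat_pow C D X k F\<close> is \<open>S\<^sup>-\<^sup>kF\<close>.\<close>

primrec sat_pow ::
  "('oc, 'ac) cat \<Rightarrow> ('od, 'ad) cat \<Rightarrow> ('oc, 'ac, 'od, 'ad) choices \<Rightarrow> nat \<Rightarrow>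
   ('oc, 'ac, 'od, 'ad) ftor \<Rightarrow> ('oc, 'ac, 'od, 'ad) ftor" where
  "sat_pow C D X 0 F = F"
| "sat_pow C D X (Suc k) F = sat C D X (sat_pow C D X k F)"

definition sat_nat ::
  "('oc, 'ac) cat \<Rightarrow> ('od, 'ad) cat \<Rightarrow> ('oc, 'ac, 'od, 'ad) choices \<Rightarrow>
   ('oc, 'ac, 'od, 'ad) ftor \<Rightarrow> ('oc, 'ac, 'od, 'ad) ftor \<Rightarrow> ('oc \<Rightarrow> 'ad) \<Rightarrow> 'oc \<Rightarrow> 'ad" where
  "sat_nat C D X F G \<phi> M =
     (THE u. u \<in> Hom D (sat_obj D X F M) (sat_obj D X G M) \<and>
        sat_inc X G M \<cdot>\<^bsub>D\<^esub> u = \<phi> (syz C X M) \<cdot>\<^bsub>D\<^esub> sat_inc X F M)"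

text \<open>\<open>sat_nat_pow C D X k F G \<phi>\<close> is \<open>S\<^sup>-\<^sup>k\<phi>\<close> for a natural transformation \<open>\<phi>: F \<rightarrow> G\<close>.\<close>

primrec sat_nat_pow ::
  "('oc, 'ac) cat \<Rightarrow> ('od, 'ad) cat \<Rightarrow> ('oc, 'ac, 'od, 'ad) choices \<Rightarrow> nat \<Rightarrow>
   ('oc, 'ac, 'od, 'ad) ftor \<Rightarrow> ('oc, 'ac, 'od, 'ad) ftor \<Rightarrow> ('oc \<Rightarrow> 'ad) \<Rightarrow> 'oc \<Rightarrow> 'ad" where
  "sat_nat_pow C D X 0 F G \<phi> = \<phi>"
| "sat_nat_pow C D X (Suc k) F G \<phi> =
     sat_nat C D X (sat_pow C D X k F) (sat_pow C D X k G) (sat_nat_pow C D X k F G \<phi>)"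

text \<open>
  \<open>sat_con C D X k F i p\<close> is \<open>\<epsilon>\<^sup>-\<^sup>k\<^sup>-\<^sup>1: S\<^sup>-\<^sup>k\<^sup>-\<^sup>1F(E) \<rightarrow> S\<^sup>-\<^sup>kF(A)\<close> for the short exact sequence with
  arrows \<open>i: A \<rightarrow> B\<close> and \<open>p: B \<rightarrow> E\<close>.
\<close>

definition sat_con ::
  "('oc, 'ac) cat \<Rightarrow> ('od, 'ad) cat \<Rightarrow> ('oc, 'ac, 'od, 'ad) choices \<Rightarrow> nat \<Rightarrow>
   ('oc, 'ac, 'od, 'ad) ftor \<Rightarrow> 'ac \<Rightarrow> 'ac \<Rightarrow> 'ad" where
  "sat_con C D X k F i p =
     Arm (sat_pow C D X k F) (syz_lift C X i p (Idn C (Cod C p))) \<cdot>\<^bsub>D\<^esub>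
     sat_inc X (sat_pow C D X k F) (Cod C p)"

text \<open>The natural transformation \<open>T\<^sup>n \<rightarrow> S\<^sup>-\<^sup>1T\<^sup>n\<^sup>+\<^sup>1\<close> through which the connecting homomorphism factors.\<close>

definition udel ::
  "('od, 'ad) cat \<Rightarrow> ('oc, 'ac, 'od, 'ad) choices \<Rightarrow> ('oc, 'ac, 'od, 'ad) cohf \<Rightarrow> int \<Rightarrow>
   'oc \<Rightarrow> 'ad" where
  "udel D X T n M =
     (THE u. u \<in> Hom D (Obm (Deg T n) M) (sat_obj D X (Deg T (n + 1)) M) \<and>
        sat_inc X (Deg T (n + 1)) M \<cdot>\<^bsub>D\<^esub> u = Con T n (Pinc X M) (Pepi X M))"


section \<open>The satellite functor construction\<close>

text \<open>\<open>trunc C D X T m\<close> is \<open>T\<langle>m\<rangle>\<close>.\<close>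

definition trunc ::
  "('oc, 'ac) cat \<Rightarrow> ('od, 'ad) cat \<Rightarrow> ('oc, 'ac, 'od, 'ad) choices \<Rightarrow>
   ('oc, 'ac, 'od, 'ad) cohf \<Rightarrow> nat \<Rightarrow> ('oc, 'ac, 'od, 'ad) cohf" where
  "trunc C D X T m =
     \<lparr>Deg = (\<lambda>k. if int m \<le> k then Deg T k
        else sat_pow C D X (nat (int m - k)) (Deg T (int m))),
      Con = (\<lambda>k i p. if int m \<le> k then Con T k i p
        else sat_con C D X (nat (int m - k - 1)) (Deg T (int m)) i p)\<rparr>"

text \<open>
  The morphism \<open>\<Phi>: T\<langle>m\<rangle> \<rightarrow> T\<langle>m'\<rangle>\<close>, for \<open>m \<le> m'\<close>. It is unique as far as its components at objects
  of \<open>\<C>\<close> are concerned; \<open>SOME\<close> is used since its values elsewhere are arbitrary.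
\<close>

definition trunc_map ::
  "('oc, 'ac) cat \<Rightarrow> ('od, 'ad) cat \<Rightarrow> ('oc, 'ac, 'od, 'ad) choices \<Rightarrow>
   ('oc, 'ac, 'od, 'ad) cohf \<Rightarrow> nat \<Rightarrow> nat \<Rightarrow> int \<Rightarrow> 'oc \<Rightarrow> 'ad" where
  "trunc_map C D X T m m' =
     (SOME \<Phi>. cohf_morphism C D (trunc C D X T m) (trunc C D X T m') \<Phi> \<and>
        (\<forall>n M. int m' \<le> n \<and> M \<in> Ob C \<longrightarrow> \<Phi> n M = Idn D (Obm (Deg T n) M)))"

text \<open>The direct limit of functors is formed objectwise; \<open>hat_leg\<close> are its structure maps.\<close>

definition hat_lim ::
  "('oc, 'ac) cat \<Rightarrow> ('od, 'ad) cat \<Rightarrow> ('oc, 'ac, 'od, 'ad) choices \<Rightarrow>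
   ('oc, 'ac, 'od, 'ad) cohf \<Rightarrow> int \<Rightarrow> 'oc \<Rightarrow> 'od \<times> (nat \<Rightarrow> 'ad)" where
  "hat_lim C D X T n M =
     Dlim X (\<lambda>m. Obm (Deg (trunc C D X T m) n) M) (\<lambda>m m'. trunc_map C D X T m m' n M)"

definition hat_obj ::
  "('oc, 'ac) cat \<Rightarrow> ('od, 'ad) cat \<Rightarrow> ('oc, 'ac, 'od, 'ad) choices \<Rightarrow>
   ('oc, 'ac, 'od, 'ad) cohf \<Rightarrow> int \<Rightarrow> 'oc \<Rightarrow> 'od" where
  "hat_obj C D X T n M = fst (hat_lim C D X T n M)"

definition hat_leg ::
  "('oc, 'ac) cat \<Rightarrow> ('od, 'ad) cat \<Rightarrow> ('oc, 'ac, 'od, 'ad) choices \<Rightarrow>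
   ('oc, 'ac, 'od, 'ad) cohf \<Rightarrow> int \<Rightarrow> 'oc \<Rightarrow> nat \<Rightarrow> 'ad" where
  "hat_leg C D X T n M = snd (hat_lim C D X T n M)"

definition hat_arr ::
  "('oc, 'ac) cat \<Rightarrow> ('od, 'ad) cat \<Rightarrow> ('oc, 'ac, 'od, 'ad) choices \<Rightarrow>
   ('oc, 'ac, 'od, 'ad) cohf \<Rightarrow> int \<Rightarrow> 'ac \<Rightarrow> 'ad" where
  "hat_arr C D X T n f =
     (THE w. is_direct_limit_map D UNIV
        (hat_obj C D X T n (Dom C f)) (hat_leg C D X T n (Dom C f))
        (hat_obj C D X T n (Cod C f)) (hat_leg C D X T n (Cod C f))
        (\<lambda>m. Arm (Deg (trunc C D X T m) n) f) w)"

definition hat ::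
  "('oc, 'ac) cat \<Rightarrow> ('od, 'ad) cat \<Rightarrow> ('oc, 'ac, 'od, 'ad) choices \<Rightarrow>
   ('oc, 'ac, 'od, 'ad) cohf \<Rightarrow> int \<Rightarrow> ('oc, 'ac, 'od, 'ad) ftor" where
  "hat C D X T n = \<lparr>Obm = hat_obj C D X T n, Arm = hat_arr C D X T n\<rparr>"

text \<open>
  For fixed \<open>n\<close>, the sequence of functors \<open>S\<^sup>-\<^sup>kT\<^sup>n\<^sup>+\<^sup>k\<close>; its \<open>k\<close>-th step is the \<open>k\<close>-th satellite of
  \<open>udel\<close> in degree \<open>n + k\<close>, which ends in \<open>S\<^sup>-\<^sup>k(S\<^sup>-\<^sup>1T\<^sup>n\<^sup>+\<^sup>k\<^sup>+\<^sup>1) = S\<^sup>-\<^sup>k\<^sup>-\<^sup>1T\<^sup>n\<^sup>+\<^sup>k\<^sup>+\<^sup>1\<close>.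
\<close>

definition sat_seq ::
  "('oc, 'ac) cat \<Rightarrow> ('od, 'ad) cat \<Rightarrow> ('oc, 'ac, 'od, 'ad) choices \<Rightarrow>
   ('oc, 'ac, 'od, 'ad) cohf \<Rightarrow> int \<Rightarrow> nat \<Rightarrow> ('oc, 'ac, 'od, 'ad) ftor" where
  "sat_seq C D X T n k = sat_pow C D X k (Deg T (n + int k))"

definition sat_seq_step ::
  "('oc, 'ac) cat \<Rightarrow> ('od, 'ad) cat \<Rightarrow> ('oc, 'ac, 'od, 'ad) choices \<Rightarrow>
   ('oc, 'ac, 'od, 'ad) cohf \<Rightarrow> int \<Rightarrow> nat \<Rightarrow> 'oc \<Rightarrow> 'ad" where
  "sat_seq_step C D X T n k =
     sat_nat_pow C D X k (Deg T (n + int k)) (sat C D X (Deg T (n + int k + 1)))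
       (udel D X T (n + int k))"

text \<open>\<open>chain D x s k d\<close> is the composite \<open>x k \<rightarrow> x (k + 1) \<rightarrow> \<dots> \<rightarrow> x (k + d)\<close> of the arrows \<open>s\<close>.\<close>

primrec chain :: "('o, 'a) cat \<Rightarrow> (nat \<Rightarrow> 'o) \<Rightarrow> (nat \<Rightarrow> 'a) \<Rightarrow> nat \<Rightarrow> nat \<Rightarrow> 'a" where
  "chain D x s k 0 = Idn D (x k)"
| "chain D x s k (Suc d) = s (k + d) \<cdot>\<^bsub>D\<^esub> chain D x s k d"

definition sat_seq_tr ::
  "('oc, 'ac) cat \<Rightarrow> ('od, 'ad) cat \<Rightarrow> ('oc, 'ac, 'od, 'ad) choices \<Rightarrow>
   ('oc, 'ac, 'od, 'ad) cohf \<Rightarrow> int \<Rightarrow> 'oc \<Rightarrow> nat \<Rightarrow> nat \<Rightarrow> 'ad" where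
  "sat_seq_tr C D X T n M k l =
     chain D (\<lambda>j. Obm (sat_seq C D X T n j) M) (\<lambda>j. sat_seq_step C D X T n j M) k (l - k)"

text \<open>
  The structure map from \<open>S\<^sup>-\<^sup>kT\<^sup>n\<^sup>+\<^sup>k(M)\<close> to \<open>hat_obj C D X T n M\<close>. If \<open>n + k \<ge> 0\<close>, then
  \<open>S\<^sup>-\<^sup>kT\<^sup>n\<^sup>+\<^sup>k = T\<langle>n + k\<rangle>\<^sup>n\<close> and this is the structure map at \<open>m = n + k\<close>. For the remaining
  finitely many \<open>k\<close>, one first passes to the smallest index \<open>l = -n\<close> with \<open>n + l \<ge> 0\<close>.
\<close>

definition sat_seq_leg ::
  "('oc, 'ac) cat \<Rightarrow> ('od, 'ad) cat \<Rightarrow> ('oc, 'ac, 'od, 'ad) choices \<Rightarrow>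
   ('oc, 'ac, 'od, 'ad) cohf \<Rightarrow> int \<Rightarrow> 'oc \<Rightarrow> nat \<Rightarrow> 'ad" where
  "sat_seq_leg C D X T n M k =
     (if 0 \<le> n + int k then hat_leg C D X T n M (nat (n + int k))
      else hat_leg C D X T n M 0 \<cdot>\<^bsub>D\<^esub> sat_seq_tr C D X T n M k (nat (- n)))"

end

theory Submission
  imports Defs
begin

text \<open>
  Two lifts of the same arrow differ by a factor through \<open>K \<rightarrow> P\<close>, which every additive functor
  kills on \<open>S\<^sup>-\<^sup>1F(M) = Ker (F(K) \<rightarrow> F(P))\<close>; hence satellites are additive functors, and the
  connecting homomorphism \<open>\<epsilon>\<close> of a chosen sequence is the kernel inclusion, a monomorphism. The
  latter determines a morphism \<open>T\<langle>m\<rangle> \<rightarrow> T\<langle>m'\<rangle>\<close> from its components in degrees \<open>\<ge> m'\<close>, so that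
  \<open>\<Phi>\<close> must consist of the composites of the arrows \<open>S\<^sup>-\<^sup>k\<delta>\<close>. In degree \<open>n\<close> the system of the
  \<open>T\<langle>m\<rangle>\<close> is therefore the system of the \<open>S\<^sup>-\<^sup>kT\<^sup>n\<^sup>+\<^sup>k\<close> pulled back along the cofinal monotone map
  \<open>m \<mapsto> max 0 (m - n)\<close>, and the limits agree.
\<close>

section \<open>Preadditive categories\<close>

context category
begin

lemma Hom_Ob:
  assumes "f \<in> Hom C A B"
  shows "A \<in> Ob C" "B \<in> Ob C"
  using assms Dom_Ob Cod_Ob by (auto simp: Hom_def)

end

context preadditive_category
begin

lemma Zer_Hom: "A \<in> Ob C \<Longrightarrow> B \<in> Ob C \<Longrightarrow> Zer C A B \<in> Hom C A B"
  using group.is_monoid[OF comm_group.axioms(2)[OF hom_comm_group], of A B]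
    monoid.one_closed by (fastforce simp: hom_group_def)

lemma Add_Hom:
  assumes "f \<in> Hom C A B" and "g \<in> Hom C A B"
  shows "Add C f g \<in> Hom C A B"
  using monoid.m_closed[OF group.is_monoid[OF comm_group.axioms(2)[OF hom_comm_group]], of A B f g]
    assms Hom_Ob[OF assms(1)] by (simp add: hom_group_def)

lemma Add_Zer:
  assumes "f \<in> Hom C A B"
  shows "Add C f (Zer C A B) = f"
  using monoid.r_one[OF group.is_monoid[OF comm_group.axioms(2)[OF hom_comm_group]], of A B f]
    assms Hom_Ob[OF assms(1)] by (simp add: hom_group_def)

text \<open>Cancellation in the hom-group. It does the work of subtraction below: an arrow is shown
  to be zero by exhibiting it as a summand that changes nothing.\<close>

lemma Add_eq_selfD:
  assumes "f \<in> Hom C A B" and "g \<in> Hom C A B" and "Add C f g = f"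
  shows "g = Zer C A B"
  using group.l_cancel_one[OF comm_group.axioms(2)[OF hom_comm_group], of A B f g]
    assms Hom_Ob[OF assms(1)] by (simp add: hom_group_def)

text \<open>The record \<open>cat\<close> has no field for negatives; they come from the group
  inverse, and only the resulting difference \<open>d\<close> is passed on, for comparing two
  lifts.\<close>

lemma ex_difference:
  assumes f: "f \<in> Hom C A B" and g: "g \<in> Hom C A B"
  obtains d where "d \<in> Hom C A B" and "f = Add C g d"
proof -
  interpret G: comm_group "hom_group C A B"
    using hom_comm_group Hom_Ob[OF f] by blast
  have c: "carrier (hom_group C A B) = Hom C A B" and m: "mult (hom_group C A B) = Add C"
    by (simp_all add: hom_group_def)
  have "inv\<^bsub>hom_group C A B\<^esub> g \<otimes>\<^bsub>hom_group C A B\<^esub> f \<in> Hom C A B"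
    using f g G.inv_closed G.m_closed unfolding c by blast
  moreover have "g \<otimes>\<^bsub>hom_group C A B\<^esub> (inv\<^bsub>hom_group C A B\<^esub> g \<otimes>\<^bsub>hom_group C A B\<^esub> f) = f"
    using f g G.inv_closed by (simp add: c flip: G.m_assoc)
  ultimately show thesis
    using that unfolding m by metis
qed

lemma Cmp_Zer:
  assumes h: "h \<in> Hom C B E" and "A \<in> Ob C"
  shows "h \<cdot>\<^bsub>C\<^esub> Zer C A B = Zer C A E"
proof -
  have z: "Zer C A B \<in> Hom C A B"
    using Zer_Hom assms Hom_Ob by blast
  \<comment> \<open>Since zero plus zero is zero, the composite added to itself is itself;
    cancellation makes it zero.\<close>
  show ?thesis
    using Add_eq_selfD[OF Cmp_Hom[OF z h] Cmp_Hom[OF z h]] Cmp_Add[OF z z h] Add_Zer[OF z] by simp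
qed

lemma Zer_Cmp:
  assumes f: "f \<in> Hom C A B" and "E \<in> Ob C"
  shows "Zer C B E \<cdot>\<^bsub>C\<^esub> f = Zer C A E"
proof -
  have z: "Zer C B E \<in> Hom C B E"
    using Zer_Hom assms Hom_Ob by blast
  show ?thesis
    using Add_eq_selfD[OF Cmp_Hom[OF f z] Cmp_Hom[OF f z]] Add_Cmp[OF f z z] Add_Zer[OF z] by simp
qed

section \<open>Kernels, cokernels and exactness\<close>

lemma kernel_Hom: "is_kernel C k g \<Longrightarrow> k \<in> Hom C (Dom C k) (Dom C g)"
  by (simp add: is_kernel_def Hom_def)

lemma kernel_Cmp: "is_kernel C k g \<Longrightarrow> g \<cdot>\<^bsub>C\<^esub> k = Zer C (Dom C k) (Cod C g)"
  by (simp add: is_kernel_def)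

lemma kernel_factor:
  assumes "is_kernel C k g" and "h \<in> Hom C A (Dom C g)" and "g \<cdot>\<^bsub>C\<^esub> h = Zer C A (Cod C g)"
  obtains u where "u \<in> Hom C A (Dom C k)" and "k \<cdot>\<^bsub>C\<^esub> u = h"
proof -
  have "h \<in> Ar C" "Cod C h = Dom C g" "Dom C h = A"
    using assms(2) by (simp_all add: Hom_def)
  then have "\<exists>!u. u \<in> Hom C (Dom C h) (Dom C k) \<and> k \<cdot>\<^bsub>C\<^esub> u = h"
    using assms(1,3) unfolding is_kernel_def by metis
  with assms(2) that show thesis
    by (auto simp: Hom_def)
qed

text \<open>\<open>g\<close> kills the composite of \<open>k\<close> and \<open>u\<close>, so the
  uniqueness clause of the universal property, applied to this composite, compares \<open>u\<close>
  with \<open>v\<close>.\<close>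

lemma kernel_cancel:
  assumes k: "is_kernel C k g" and u: "u \<in> Hom C A (Dom C k)" and v: "v \<in> Hom C A (Dom C k)"
    and eq: "k \<cdot>\<^bsub>C\<^esub> u = k \<cdot>\<^bsub>C\<^esub> v"
  shows "u = v"
proof -
  have g: "g \<in> Hom C (Dom C g) (Cod C g)"
    using k by (simp add: is_kernel_def Hom_def)
  have ku: "k \<cdot>\<^bsub>C\<^esub> u \<in> Hom C A (Dom C g)"
    using Cmp_Hom[OF u kernel_Hom[OF k]] .
  have "g \<cdot>\<^bsub>C\<^esub> (k \<cdot>\<^bsub>C\<^esub> u) = Zer C A (Cod C g)"
    using Cmp_assoc[OF u kernel_Hom[OF k] g] kernel_Cmp[OF k] Zer_Cmp[OF u] Hom_Ob[OF g] by simp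
  moreover have "k \<cdot>\<^bsub>C\<^esub> u \<in> Ar C" "Cod C (k \<cdot>\<^bsub>C\<^esub> u) = Dom C g" "Dom C (k \<cdot>\<^bsub>C\<^esub> u) = A"
    using ku by (simp_all add: Hom_def)
  ultimately have "\<exists>!w. w \<in> Hom C A (Dom C k) \<and> k \<cdot>\<^bsub>C\<^esub> w = k \<cdot>\<^bsub>C\<^esub> u"
    using k unfolding is_kernel_def by metis
  then show ?thesis
    using u v eq by metis
qed

text \<open>Both arrows solve the same factorisation problem through the cokernel. The result makes
  \<open>projective\<close> applicable to the second arrow of a short exact sequence.\<close>

lemma cokernel_epi:
  assumes c: "is_cokernel C c g"
  shows "is_epi C c"
  unfolding is_epi_def
proof (intro conjI allI ballI impI)
  show "c \<in> Ar C"
    using c by (simp add: is_cokernel_def)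
next
  fix A u v
  assume u: "u \<in> Hom C (Cod C c) A" and v: "v \<in> Hom C (Cod C c) A"
    and eq: "u \<cdot>\<^bsub>C\<^esub> c = v \<cdot>\<^bsub>C\<^esub> c"
  have g: "g \<in> Hom C (Dom C g) (Cod C g)" and cH: "c \<in> Hom C (Cod C g) (Cod C c)"
    using c by (simp_all add: is_cokernel_def Hom_def)
  have uc: "u \<cdot>\<^bsub>C\<^esub> c \<in> Hom C (Cod C g) A"
    using Cmp_Hom[OF cH u] .
  have "(u \<cdot>\<^bsub>C\<^esub> c) \<cdot>\<^bsub>C\<^esub> g = Zer C (Dom C g) A"
    using Cmp_assoc[OF g cH u] Cmp_Zer[OF u] Hom_Ob[OF g] c by (simp add: is_cokernel_def)
  moreover have "u \<cdot>\<^bsub>C\<^esub> c \<in> Ar C" "Dom C (u \<cdot>\<^bsub>C\<^esub> c) = Cod C g" "Cod C (u \<cdot>\<^bsub>C\<^esub> c) = A"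
    using uc by (simp_all add: Hom_def)
  ultimately have "\<exists>!w. w \<in> Hom C (Cod C c) A \<and> w \<cdot>\<^bsub>C\<^esub> c = u \<cdot>\<^bsub>C\<^esub> c"
    using c unfolding is_cokernel_def by metis
  then show "u = v"
    using u v eq by metis
qed

text \<open>\<open>f\<close> factors through its image inclusion \<open>i\<close>, a kernel of its
  cokernel; being a kernel of \<open>g\<close> as well, \<open>i\<close> is killed by
  \<open>g\<close>. This is what makes a connecting homomorphism land in the kernel that defines the
  satellite.\<close>

lemma exact_pair_Cmp:
  assumes ex: "exact_pair C f g" and f: "f \<in> Hom C A B" and g: "g \<in> Hom C B E"
  shows "g \<cdot>\<^bsub>C\<^esub> f = Zer C A E"
proof -
  obtain c i where c: "is_cokernel C c f" and i: "is_kernel C i c" and ig: "is_kernel C i g"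
    using ex by (auto simp: exact_pair_def)
  have "f \<in> Hom C A (Dom C c)" "c \<cdot>\<^bsub>C\<^esub> f = Zer C A (Cod C c)"
    using c f by (auto simp: is_cokernel_def Hom_def)
  then obtain u where u: "u \<in> Hom C A (Dom C i)" and iu: "i \<cdot>\<^bsub>C\<^esub> u = f"
    using kernel_factor[OF i] by blast
  have iH: "i \<in> Hom C (Dom C i) B" and gi: "g \<cdot>\<^bsub>C\<^esub> i = Zer C (Dom C i) E"
    using kernel_Hom[OF ig] kernel_Cmp[OF ig] g by (auto simp: Hom_def)
  show ?thesis
    using Cmp_assoc[OF u iH g] Zer_Cmp[OF u] Hom_Ob[OF g] gi iu by simp
qed

end


section \<open>Additive functors and satellites\<close>

lemma additive_functorD:
  assumes "additive_functor C D F"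
  shows "A \<in> Ob C \<Longrightarrow> Obm F A \<in> Ob D"
    and "f \<in> Hom C A B \<Longrightarrow> Arm F f \<in> Hom D (Obm F A) (Obm F B)"
    and "A \<in> Ob C \<Longrightarrow> Arm F (Idn C A) = Idn D (Obm F A)"
    and "f \<in> Hom C A B \<Longrightarrow> g \<in> Hom C B E \<Longrightarrow> Arm F (g \<cdot>\<^bsub>C\<^esub> f) = Arm F g \<cdot>\<^bsub>D\<^esub> Arm F f"
    and "f \<in> Hom C A B \<Longrightarrow> h \<in> Hom C A B \<Longrightarrow> Arm F (Add C f h) = Add D (Arm F f) (Arm F h)"
  using assms unfolding additive_functor_def by blast+

lemma nat_transD:
  assumes "nat_trans C D F G \<phi>"
  shows "A \<in> Ob C \<Longrightarrow> \<phi> A \<in> Hom D (Obm F A) (Obm G A)"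
    and "f \<in> Hom C A B \<Longrightarrow> \<phi> B \<cdot>\<^bsub>D\<^esub> Arm F f = Arm G f \<cdot>\<^bsub>D\<^esub> \<phi> A"
  using assms unfolding nat_trans_def by blast+

locale satellites = C: preadditive_category C + D: preadditive_category D
  for C :: "('oc, 'ac) cat" and D :: "('od, 'ad) cat" +
  fixes X :: "('oc, 'ac, 'od, 'ad) choices"
  assumes choices: "satellite_choices C D X"
begin

section \<open>Chosen projective sequences and lifts\<close>

lemma resolution:
  assumes "M \<in> Ob C"
  shows "short_exact C (Pinc X M) (Pepi X M)" and "Cod C (Pepi X M) = M"
    and "projective C (Dom C (Pepi X M))"
  using choices assms by (simp_all add: satellite_choices_def)

lemma Pepi_Hom: "M \<in> Ob C \<Longrightarrow> Pepi X M \<in> Hom C (Dom C (Pepi X M)) M"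
  using resolution by (fastforce simp: short_exact_def is_kernel_def Hom_def)

lemma short_exact_Hom:
  assumes "short_exact C i p"
  shows "i \<in> Hom C (Dom C i) (Dom C p)" and "p \<in> Hom C (Dom C p) (Cod C p)"
  using assms by (simp_all add: short_exact_def is_kernel_def Hom_def)

lemma Pinc_Hom: "M \<in> Ob C \<Longrightarrow> Pinc X M \<in> Hom C (syz C X M) (Dom C (Pepi X M))"
  using short_exact_Hom(1)[OF resolution(1)] by (simp add: syz_def)

lemma syz_Ob: "M \<in> Ob C \<Longrightarrow> syz C X M \<in> Ob C"
  using C.Hom_Ob(1)[OF Pinc_Hom] .

lemma Pepi_Pinc:
  assumes "M \<in> Ob C"
  shows "Pepi X M \<cdot>\<^bsub>C\<^esub> Pinc X M = Zer C (syz C X M) M"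
  using C.kernel_Cmp[of "Pinc X M" "Pepi X M"] resolution[OF assms]
  by (simp add: short_exact_def syz_def)

text \<open>The \<open>SOME\<close> in \<open>proj_lift\<close> has a witness: \<open>p\<close> is a
  cokernel, hence epi, and the object chosen over \<open>M\<close> is projective.\<close>

lemma proj_lift:
  assumes ip: "short_exact C i p" and f: "f \<in> Hom C M (Cod C p)"
  shows "proj_lift C X p f \<in> Hom C (Dom C (Pepi X M)) (Dom C p)"
    and "p \<cdot>\<^bsub>C\<^esub> proj_lift C X p f = f \<cdot>\<^bsub>C\<^esub> Pepi X M"
proof -
  have M: "M \<in> Ob C" "Dom C f = M"
    using C.Hom_Ob[OF f] f by (auto simp: Hom_def)
  have "is_epi C p"
    using ip C.cokernel_epi by (auto simp: short_exact_def)
  then have "\<exists>h. h \<in> Hom C (Dom C (Pepi X M)) (Dom C p) \<and> p \<cdot>\<^bsub>C\<^esub> h = f \<cdot>\<^bsub>C\<^esub> Pepi X M"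
    using resolution(3)[OF M(1)] C.Cmp_Hom[OF Pepi_Hom[OF M(1)] f]
    unfolding projective_def by blast
  from someI_ex[OF this] M(2)
  show "proj_lift C X p f \<in> Hom C (Dom C (Pepi X M)) (Dom C p)"
    and "p \<cdot>\<^bsub>C\<^esub> proj_lift C X p f = f \<cdot>\<^bsub>C\<^esub> Pepi X M"
    unfolding proj_lift_def by simp_all
qed

text \<open>\<open>p\<close> kills the lift restricted to the syzygy, because there it equals
  \<open>f\<close> after the zero composite of \<open>Pepi\<close> and \<open>Pinc\<close>; hence
  the restriction factors through the kernel \<open>i\<close>.\<close>

lemma syz_lift:
  assumes ip: "short_exact C i p" and f: "f \<in> Hom C M (Cod C p)"
  shows "syz_lift C X i p f \<in> Hom C (syz C X M) (Dom C i)"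
    and "i \<cdot>\<^bsub>C\<^esub> syz_lift C X i p f = proj_lift C X p f \<cdot>\<^bsub>C\<^esub> Pinc X M"
proof -
  have M: "M \<in> Ob C" "Dom C f = M" and K: "is_kernel C i p"
    using C.Hom_Ob[OF f] f ip by (auto simp: Hom_def short_exact_def)
  note h = proj_lift[OF ip f]
  have "p \<cdot>\<^bsub>C\<^esub> (proj_lift C X p f \<cdot>\<^bsub>C\<^esub> Pinc X M) = f \<cdot>\<^bsub>C\<^esub> (Pepi X M \<cdot>\<^bsub>C\<^esub> Pinc X M)"
    using C.Cmp_assoc[OF Pinc_Hom h(1) short_exact_Hom(2)[OF ip]]
      C.Cmp_assoc[OF Pinc_Hom Pepi_Hom f] h(2) M(1) by simp
  also have "\<dots> = Zer C (syz C X M) (Cod C p)"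
    using Pepi_Pinc C.Cmp_Zer[OF f] syz_Ob M(1) by simp
  finally obtain u where u: "u \<in> Hom C (syz C X M) (Dom C i)"
      "i \<cdot>\<^bsub>C\<^esub> u = proj_lift C X p f \<cdot>\<^bsub>C\<^esub> Pinc X M"
    using C.kernel_factor[OF K C.Cmp_Hom[OF Pinc_Hom[OF M(1)] h(1)]] by blast
  have "syz_lift C X i p f = u"
    unfolding syz_lift_def M(2) using u C.kernel_cancel[OF K] by (intro the_equality) auto
  with u show "syz_lift C X i p f \<in> Hom C (syz C X M) (Dom C i)"
    and "i \<cdot>\<^bsub>C\<^esub> syz_lift C X i p f = proj_lift C X p f \<cdot>\<^bsub>C\<^esub> Pinc X M"
    by simp_all
qed

section \<open>The kernel defining the satellite\<close>

lemma sat_inc_kernel: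
  assumes "additive_functor C D F" and "M \<in> Ob C"
  shows "is_kernel D (sat_inc X F M) (Arm F (Pinc X M))"
  using additive_functorD(2)[OF assms(1) Pinc_Hom[OF assms(2)]] choices
  unfolding satellite_choices_def sat_inc_def by (simp add: Hom_def)

lemma sat_inc_Hom:
  assumes "additive_functor C D F" and "M \<in> Ob C"
  shows "sat_inc X F M \<in> Hom D (sat_obj D X F M) (Obm F (syz C X M))"
  using D.kernel_Hom[OF sat_inc_kernel[OF assms]]
    additive_functorD(2)[OF assms(1) Pinc_Hom[OF assms(2)]]
  by (simp add: sat_obj_def Hom_def)

lemma sat_obj_Ob: "additive_functor C D F \<Longrightarrow> M \<in> Ob C \<Longrightarrow> sat_obj D X F M \<in> Ob D"
  using D.Hom_Ob(1)[OF sat_inc_Hom] .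

lemma Pinc_sat_inc:
  assumes "additive_functor C D F" and "M \<in> Ob C"
  shows "Arm F (Pinc X M) \<cdot>\<^bsub>D\<^esub> sat_inc X F M = Zer D (sat_obj D X F M) (Obm F (Dom C (Pepi X M)))"
  using D.kernel_Cmp[OF sat_inc_kernel[OF assms]]
    additive_functorD(2)[OF assms(1) Pinc_Hom[OF assms(2)]]
  by (simp add: sat_obj_def Hom_def)

lemma sat_inc_cancel:
  assumes "additive_functor C D F" and "M \<in> Ob C"
    and "u \<in> Hom D Y (sat_obj D X F M)" and "v \<in> Hom D Y (sat_obj D X F M)"
    and "sat_inc X F M \<cdot>\<^bsub>D\<^esub> u = sat_inc X F M \<cdot>\<^bsub>D\<^esub> v"
  shows "u = v"
  using D.kernel_cancel[OF sat_inc_kernel[OF assms(1,2)]] assms(3-5) by (simp add: sat_obj_def)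

text \<open>The universal property in the shape required by the \<open>THE\<close> descriptions of
  \<open>sat_arr\<close>, \<open>sat_nat\<close> and \<open>udel\<close>.\<close>

lemma sat_inc_ex1:
  assumes F: "additive_functor C D F" and M: "M \<in> Ob C" and h: "h \<in> Hom D Y (Obm F (syz C X M))"
    and z: "Arm F (Pinc X M) \<cdot>\<^bsub>D\<^esub> h = Zer D Y (Obm F (Dom C (Pepi X M)))"
  shows "\<exists>!u. u \<in> Hom D Y (sat_obj D X F M) \<and> sat_inc X F M \<cdot>\<^bsub>D\<^esub> u = h"
proof -
  have "Arm F (Pinc X M) \<in> Hom D (Obm F (syz C X M)) (Obm F (Dom C (Pepi X M)))"
    using additive_functorD(2)[OF F Pinc_Hom[OF M]] .
  then obtain u where "u \<in> Hom D Y (sat_obj D X F M)" "sat_inc X F M \<cdot>\<^bsub>D\<^esub> u = h"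
    using D.kernel_factor[OF sat_inc_kernel[OF F M], of h Y] h z
    by (auto simp: Hom_def sat_obj_def)
  then show ?thesis
    using sat_inc_cancel[OF F M] by metis
qed

text \<open>A homotopy argument: the two induced arrows on the syzygy differ by a composite
  \<open>s\<close> after \<open>Pinc X M\<close>, and \<open>F\<close> of \<open>Pinc X M\<close>
  vanishes on the kernel.\<close>

lemma lift_unique:
  assumes F: "additive_functor C D F" and M: "M \<in> Ob C" and ip: "short_exact C i p"
    and h: "h \<in> Hom C (Dom C (Pepi X M)) (Dom C p)"
    and h': "h' \<in> Hom C (Dom C (Pepi X M)) (Dom C p)"
    and eq: "p \<cdot>\<^bsub>C\<^esub> h = p \<cdot>\<^bsub>C\<^esub> h'"
    and u: "u \<in> Hom C (syz C X M) (Dom C i)" and iu: "i \<cdot>\<^bsub>C\<^esub> u = h \<cdot>\<^bsub>C\<^esub> Pinc X M"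
    and u': "u' \<in> Hom C (syz C X M) (Dom C i)" and iu': "i \<cdot>\<^bsub>C\<^esub> u' = h' \<cdot>\<^bsub>C\<^esub> Pinc X M"
  shows "Arm F u \<cdot>\<^bsub>D\<^esub> sat_inc X F M = Arm F u' \<cdot>\<^bsub>D\<^esub> sat_inc X F M"
proof -
  note iH = short_exact_Hom(1)[OF ip] and pH = short_exact_Hom(2)[OF ip]
  note j = Pinc_Hom[OF M] and k = sat_inc_Hom[OF F M]
  have K: "is_kernel C i p"
    using ip by (simp add: short_exact_def)
  obtain d where d: "d \<in> Hom C (Dom C (Pepi X M)) (Dom C p)" and hd: "h = Add C h' d"
    using C.ex_difference[OF h h'] .
  have "p \<cdot>\<^bsub>C\<^esub> d = Zer C (Dom C (Pepi X M)) (Cod C p)"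
    using C.Add_eq_selfD[OF C.Cmp_Hom[OF h' pH] C.Cmp_Hom[OF d pH]] C.Cmp_Add[OF h' d pH] eq hd
    by simp
  \<comment> \<open>The homotopy: the difference \<open>d\<close> of the two lifts is killed by
    \<open>p\<close>, so it factors through the kernel \<open>i\<close>.\<close>
  then obtain s where s: "s \<in> Hom C (Dom C (Pepi X M)) (Dom C i)" and si: "i \<cdot>\<^bsub>C\<^esub> s = d"
    using C.kernel_factor[OF K d] by blast
  note sj = C.Cmp_Hom[OF j s]
  have "i \<cdot>\<^bsub>C\<^esub> Add C u' (s \<cdot>\<^bsub>C\<^esub> Pinc X M) = i \<cdot>\<^bsub>C\<^esub> u"
    using C.Cmp_Add[OF u' sj iH] C.Cmp_assoc[OF j s iH] C.Add_Cmp[OF j h' d] iu iu' si hd by simp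
  then have ueq: "u = Add C u' (s \<cdot>\<^bsub>C\<^esub> Pinc X M)"
    using C.kernel_cancel[OF K u C.Add_Hom[OF u' sj]] by simp
  note Fj = additive_functorD(2)[OF F j] and Fs = additive_functorD(2)[OF F s]
    and Fu' = additive_functorD(2)[OF F u']
  have "Arm F u \<cdot>\<^bsub>D\<^esub> sat_inc X F M =
      Add D (Arm F u' \<cdot>\<^bsub>D\<^esub> sat_inc X F M) ((Arm F s \<cdot>\<^bsub>D\<^esub> Arm F (Pinc X M)) \<cdot>\<^bsub>D\<^esub> sat_inc X F M)"
    using additive_functorD(5)[OF F u' sj] additive_functorD(4)[OF F j s] ueq
      D.Add_Cmp[OF k Fu' D.Cmp_Hom[OF Fj Fs]] by simp
  also have "(Arm F s \<cdot>\<^bsub>D\<^esub> Arm F (Pinc X M)) \<cdot>\<^bsub>D\<^esub> sat_inc X F M =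
      Zer D (sat_obj D X F M) (Obm F (Dom C i))"
    using D.Cmp_assoc[OF k Fj Fs] Pinc_sat_inc[OF F M] D.Cmp_Zer[OF Fs sat_obj_Ob[OF F M]] by simp
  finally show ?thesis
    using D.Add_Zer[OF D.Cmp_Hom[OF k Fu']] by simp
qed

text \<open>Frees later arguments from the lift picked by \<open>SOME\<close>: after restriction to
  the kernel, any convenient lift \<open>h\<close> with its induced \<open>u\<close> gives the same
  result.\<close>

lemma syz_lift_unique:
  assumes F: "additive_functor C D F" and f: "f \<in> Hom C M (Cod C p)" and ip: "short_exact C i p"
    and h: "h \<in> Hom C (Dom C (Pepi X M)) (Dom C p)" and ph: "p \<cdot>\<^bsub>C\<^esub> h = f \<cdot>\<^bsub>C\<^esub> Pepi X M"
    and u: "u \<in> Hom C (syz C X M) (Dom C i)" and iu: "i \<cdot>\<^bsub>C\<^esub> u = h \<cdot>\<^bsub>C\<^esub> Pinc X M"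
  shows "Arm F (syz_lift C X i p f) \<cdot>\<^bsub>D\<^esub> sat_inc X F M = Arm F u \<cdot>\<^bsub>D\<^esub> sat_inc X F M"
  using lift_unique[OF F C.Hom_Ob(1)[OF f] ip proj_lift(1)[OF ip f] h _ syz_lift[OF ip f] u iu]
    proj_lift(2)[OF ip f] ph by simp

section \<open>Satellites on arrows\<close>

definition syz_arr :: "'ac \<Rightarrow> 'ac" where
  "syz_arr f = syz_lift C X (Pinc X (Cod C f)) (Pepi X (Cod C f)) f"

definition proj_arr :: "'ac \<Rightarrow> 'ac" where
  "proj_arr f = proj_lift C X (Pepi X (Cod C f)) f"

lemma syz_arr:
  assumes f: "f \<in> Hom C M N"
  shows "syz_arr f \<in> Hom C (syz C X M) (syz C X N)"
    and "Pinc X N \<cdot>\<^bsub>C\<^esub> syz_arr f = proj_arr f \<cdot>\<^bsub>C\<^esub> Pinc X M"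
    and "proj_arr f \<in> Hom C (Dom C (Pepi X M)) (Dom C (Pepi X N))"
    and "Pepi X N \<cdot>\<^bsub>C\<^esub> proj_arr f = f \<cdot>\<^bsub>C\<^esub> Pepi X M"
proof -
  have N: "N \<in> Ob C" "Cod C f = N"
    using C.Hom_Ob[OF f] f by (auto simp: Hom_def)
  have f': "f \<in> Hom C M (Cod C (Pepi X N))"
    using f resolution(2)[OF N(1)] by simp
  note r = resolution(1)[OF N(1)]
  show "syz_arr f \<in> Hom C (syz C X M) (syz C X N)"
    and "Pinc X N \<cdot>\<^bsub>C\<^esub> syz_arr f = proj_arr f \<cdot>\<^bsub>C\<^esub> Pinc X M"
    and "proj_arr f \<in> Hom C (Dom C (Pepi X M)) (Dom C (Pepi X N))"
    and "Pepi X N \<cdot>\<^bsub>C\<^esub> proj_arr f = f \<cdot>\<^bsub>C\<^esub> Pepi X M"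
    using syz_lift[OF r f'] proj_lift[OF r f'] N(2)
    by (simp_all add: syz_arr_def proj_arr_def syz_def)
qed

lemma syz_arr_unique:
  assumes F: "additive_functor C D F" and f: "f \<in> Hom C M N"
    and h: "h \<in> Hom C (Dom C (Pepi X M)) (Dom C (Pepi X N))"
    and ph: "Pepi X N \<cdot>\<^bsub>C\<^esub> h = f \<cdot>\<^bsub>C\<^esub> Pepi X M"
    and u: "u \<in> Hom C (syz C X M) (syz C X N)" and iu: "Pinc X N \<cdot>\<^bsub>C\<^esub> u = h \<cdot>\<^bsub>C\<^esub> Pinc X M"
  shows "Arm F (syz_arr f) \<cdot>\<^bsub>D\<^esub> sat_inc X F M = Arm F u \<cdot>\<^bsub>D\<^esub> sat_inc X F M"
proof -
  have N: "N \<in> Ob C" "Cod C f = N"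
    using C.Hom_Ob[OF f] f by (auto simp: Hom_def)
  then show ?thesis
    using syz_lift_unique[OF F _ resolution(1)[OF N(1)] h ph _ iu] f u resolution(2)[OF N(1)]
    by (simp add: syz_arr_def syz_def)
qed

text \<open>\<open>F\<close> applied to the square of \<open>syz_arr f\<close> and
  \<open>proj_arr f\<close> carries the vanishing of \<open>F\<close> of \<open>Pinc\<close> on the
  kernel from \<open>M\<close> over to \<open>N\<close>.\<close>

lemma sat_arr_ex1:
  assumes F: "additive_functor C D F" and f: "f \<in> Hom C M N"
  shows "\<exists>!u. u \<in> Hom D (sat_obj D X F M) (sat_obj D X F N) \<and>
    sat_inc X F N \<cdot>\<^bsub>D\<^esub> u = Arm F (syz_arr f) \<cdot>\<^bsub>D\<^esub> sat_inc X F M"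
proof -
  note Ob = C.Hom_Ob[OF f]
  note s = syz_arr[OF f] and k = sat_inc_Hom[OF F Ob(1)]
  note Fs = additive_functorD(2)[OF F s(1)]
    and Fh = additive_functorD(2)[OF F s(3)]
    and FM = additive_functorD(2)[OF F Pinc_Hom[OF Ob(1)]]
    and FN = additive_functorD(2)[OF F Pinc_Hom[OF Ob(2)]]
  have "Arm F (Pinc X N) \<cdot>\<^bsub>D\<^esub> (Arm F (syz_arr f) \<cdot>\<^bsub>D\<^esub> sat_inc X F M)
      = Arm F (proj_arr f) \<cdot>\<^bsub>D\<^esub> (Arm F (Pinc X M) \<cdot>\<^bsub>D\<^esub> sat_inc X F M)"
    using D.Cmp_assoc[OF k Fs FN] D.Cmp_assoc[OF k FM Fh] s(2)
      additive_functorD(4)[OF F s(1) Pinc_Hom[OF Ob(2)]]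
      additive_functorD(4)[OF F Pinc_Hom[OF Ob(1)] s(3)] by simp
  then show ?thesis
    using sat_inc_ex1[OF F Ob(2) D.Cmp_Hom[OF k Fs]] Pinc_sat_inc[OF F Ob(1)]
      D.Cmp_Zer[OF Fh] sat_obj_Ob[OF F Ob(1)] by simp
qed

lemma sat_arr:
  assumes F: "additive_functor C D F" and f: "f \<in> Hom C M N"
  shows "sat_arr C D X F f \<in> Hom D (sat_obj D X F M) (sat_obj D X F N)"
    and "sat_inc X F N \<cdot>\<^bsub>D\<^esub> sat_arr C D X F f = Arm F (syz_arr f) \<cdot>\<^bsub>D\<^esub> sat_inc X F M"
proof -
  have "Dom C f = M" "Cod C f = N"
    using f by (auto simp: Hom_def)
  then show "sat_arr C D X F f \<in> Hom D (sat_obj D X F M) (sat_obj D X F N)"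
    and "sat_inc X F N \<cdot>\<^bsub>D\<^esub> sat_arr C D X F f = Arm F (syz_arr f) \<cdot>\<^bsub>D\<^esub> sat_inc X F M"
    using theI'[OF sat_arr_ex1[OF F f]] by (simp_all add: sat_arr_def syz_arr_def)
qed

text \<open>\<open>syz_arr\<close> itself need not respect identities, composites or sums, since its
  lifts are arbitrary choices. After \<open>sat_inc\<close> the choice is invisible, so each functor
  law below follows from one explicit lift: an identity, a composite or a sum.\<close>

lemma sat_arr_eqI:
  assumes F: "additive_functor C D F" and f: "f \<in> Hom C M N"
    and h: "h \<in> Hom C (Dom C (Pepi X M)) (Dom C (Pepi X N))"
    and ph: "Pepi X N \<cdot>\<^bsub>C\<^esub> h = f \<cdot>\<^bsub>C\<^esub> Pepi X M"
    and u: "u \<in> Hom C (syz C X M) (syz C X N)" and iu: "Pinc X N \<cdot>\<^bsub>C\<^esub> u = h \<cdot>\<^bsub>C\<^esub> Pinc X M"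
    and v: "v \<in> Hom D (sat_obj D X F M) (sat_obj D X F N)"
    and iv: "sat_inc X F N \<cdot>\<^bsub>D\<^esub> v = Arm F u \<cdot>\<^bsub>D\<^esub> sat_inc X F M"
  shows "sat_arr C D X F f = v"
  using sat_inc_cancel[OF F C.Hom_Ob(2)[OF f] sat_arr(1)[OF F f] v]
    sat_arr(2)[OF F f] syz_arr_unique[OF F f h ph u iu] iv by simp

lemma sat_arr_Idn:
  assumes F: "additive_functor C D F" and M: "M \<in> Ob C"
  shows "sat_arr C D X F (Idn C M) = Idn D (sat_obj D X F M)"
proof (rule sat_arr_eqI[OF F C.Idn_Hom[OF M]])
  have P: "Dom C (Pepi X M) \<in> Ob C"
    using C.Hom_Ob(1)[OF Pepi_Hom[OF M]] .
  show "Idn C (Dom C (Pepi X M)) \<in> Hom C (Dom C (Pepi X M)) (Dom C (Pepi X M))"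
    using C.Idn_Hom[OF P] .
  show "Pepi X M \<cdot>\<^bsub>C\<^esub> Idn C (Dom C (Pepi X M)) = Idn C M \<cdot>\<^bsub>C\<^esub> Pepi X M"
    using C.Cmp_Idn[OF Pepi_Hom[OF M]] C.Idn_Cmp[OF Pepi_Hom[OF M]] by simp
  show "Idn C (syz C X M) \<in> Hom C (syz C X M) (syz C X M)"
    using C.Idn_Hom[OF syz_Ob[OF M]] .
  show "Pinc X M \<cdot>\<^bsub>C\<^esub> Idn C (syz C X M) = Idn C (Dom C (Pepi X M)) \<cdot>\<^bsub>C\<^esub> Pinc X M"
    using C.Cmp_Idn[OF Pinc_Hom[OF M]] C.Idn_Cmp[OF Pinc_Hom[OF M]] by simp
  show "Idn D (sat_obj D X F M) \<in> Hom D (sat_obj D X F M) (sat_obj D X F M)"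
    using D.Idn_Hom[OF sat_obj_Ob[OF F M]] .
  show "sat_inc X F M \<cdot>\<^bsub>D\<^esub> Idn D (sat_obj D X F M) = Arm F (Idn C (syz C X M)) \<cdot>\<^bsub>D\<^esub> sat_inc X F M"
    using D.Cmp_Idn[OF sat_inc_Hom[OF F M]] D.Idn_Cmp[OF sat_inc_Hom[OF F M]]
      additive_functorD(3)[OF F syz_Ob[OF M]] by simp
qed

lemma sat_arr_Cmp:
  assumes F: "additive_functor C D F" and f: "f \<in> Hom C L M" and g: "g \<in> Hom C M N"
  shows "sat_arr C D X F (g \<cdot>\<^bsub>C\<^esub> f) = sat_arr C D X F g \<cdot>\<^bsub>D\<^esub> sat_arr C D X F f"
proof (rule sat_arr_eqI[OF F C.Cmp_Hom[OF f g]])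
  note L = C.Hom_Ob(1)[OF f] and M = C.Hom_Ob(1)[OF g] and N = C.Hom_Ob(2)[OF g]
  note sf = syz_arr[OF f] and sg = syz_arr[OF g]
  note af = sat_arr[OF F f] and ag = sat_arr[OF F g]
  note Fsf = additive_functorD(2)[OF F sf(1)] and Fsg = additive_functorD(2)[OF F sg(1)]
  show "proj_arr g \<cdot>\<^bsub>C\<^esub> proj_arr f \<in> Hom C (Dom C (Pepi X L)) (Dom C (Pepi X N))"
    using C.Cmp_Hom[OF sf(3) sg(3)] .
  have "Pepi X N \<cdot>\<^bsub>C\<^esub> (proj_arr g \<cdot>\<^bsub>C\<^esub> proj_arr f) = (g \<cdot>\<^bsub>C\<^esub> Pepi X M) \<cdot>\<^bsub>C\<^esub> proj_arr f"
    using C.Cmp_assoc[OF sf(3) sg(3) Pepi_Hom[OF N]] sg(4) by simp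
  also have "\<dots> = g \<cdot>\<^bsub>C\<^esub> (f \<cdot>\<^bsub>C\<^esub> Pepi X L)"
    using C.Cmp_assoc[OF sf(3) Pepi_Hom[OF M] g] sf(4) by simp
  also have "\<dots> = (g \<cdot>\<^bsub>C\<^esub> f) \<cdot>\<^bsub>C\<^esub> Pepi X L"
    using C.Cmp_assoc[OF Pepi_Hom[OF L] f g] by simp
  finally show "Pepi X N \<cdot>\<^bsub>C\<^esub> (proj_arr g \<cdot>\<^bsub>C\<^esub> proj_arr f) = (g \<cdot>\<^bsub>C\<^esub> f) \<cdot>\<^bsub>C\<^esub> Pepi X L" .
  show "syz_arr g \<cdot>\<^bsub>C\<^esub> syz_arr f \<in> Hom C (syz C X L) (syz C X N)"
    using C.Cmp_Hom[OF sf(1) sg(1)] .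
  have "Pinc X N \<cdot>\<^bsub>C\<^esub> (syz_arr g \<cdot>\<^bsub>C\<^esub> syz_arr f) = (proj_arr g \<cdot>\<^bsub>C\<^esub> Pinc X M) \<cdot>\<^bsub>C\<^esub> syz_arr f"
    using C.Cmp_assoc[OF sf(1) sg(1) Pinc_Hom[OF N]] sg(2) by simp
  also have "\<dots> = proj_arr g \<cdot>\<^bsub>C\<^esub> (proj_arr f \<cdot>\<^bsub>C\<^esub> Pinc X L)"
    using C.Cmp_assoc[OF sf(1) Pinc_Hom[OF M] sg(3)] sf(2) by simp
  also have "\<dots> = (proj_arr g \<cdot>\<^bsub>C\<^esub> proj_arr f) \<cdot>\<^bsub>C\<^esub> Pinc X L"
    using C.Cmp_assoc[OF Pinc_Hom[OF L] sf(3) sg(3)] by simp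
  finally show "Pinc X N \<cdot>\<^bsub>C\<^esub> (syz_arr g \<cdot>\<^bsub>C\<^esub> syz_arr f) =
    (proj_arr g \<cdot>\<^bsub>C\<^esub> proj_arr f) \<cdot>\<^bsub>C\<^esub> Pinc X L" .
  show "sat_arr C D X F g \<cdot>\<^bsub>D\<^esub> sat_arr C D X F f \<in> Hom D (sat_obj D X F L) (sat_obj D X F N)"
    using D.Cmp_Hom[OF af(1) ag(1)] .
  have "sat_inc X F N \<cdot>\<^bsub>D\<^esub> (sat_arr C D X F g \<cdot>\<^bsub>D\<^esub> sat_arr C D X F f) =
      (Arm F (syz_arr g) \<cdot>\<^bsub>D\<^esub> sat_inc X F M) \<cdot>\<^bsub>D\<^esub> sat_arr C D X F f"
    using D.Cmp_assoc[OF af(1) ag(1) sat_inc_Hom[OF F N]] ag(2) by simp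
  also have "\<dots> = Arm F (syz_arr g) \<cdot>\<^bsub>D\<^esub> (Arm F (syz_arr f) \<cdot>\<^bsub>D\<^esub> sat_inc X F L)"
    using D.Cmp_assoc[OF af(1) sat_inc_Hom[OF F M] Fsg] af(2) by simp
  also have "\<dots> = Arm F (syz_arr g \<cdot>\<^bsub>C\<^esub> syz_arr f) \<cdot>\<^bsub>D\<^esub> sat_inc X F L"
    using D.Cmp_assoc[OF sat_inc_Hom[OF F L] Fsf Fsg] additive_functorD(4)[OF F sf(1) sg(1)] by simp
  finally show "sat_inc X F N \<cdot>\<^bsub>D\<^esub> (sat_arr C D X F g \<cdot>\<^bsub>D\<^esub> sat_arr C D X F f) =
    Arm F (syz_arr g \<cdot>\<^bsub>C\<^esub> syz_arr f) \<cdot>\<^bsub>D\<^esub> sat_inc X F L" .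
qed

lemma sat_arr_Add:
  assumes F: "additive_functor C D F" and f: "f \<in> Hom C M N" and g: "g \<in> Hom C M N"
  shows "sat_arr C D X F (Add C f g) = Add D (sat_arr C D X F f) (sat_arr C D X F g)"
proof (rule sat_arr_eqI[OF F C.Add_Hom[OF f g]])
  note M = C.Hom_Ob(1)[OF f] and N = C.Hom_Ob(2)[OF f]
  note sf = syz_arr[OF f] and sg = syz_arr[OF g]
  note af = sat_arr[OF F f] and ag = sat_arr[OF F g]
  note Fsf = additive_functorD(2)[OF F sf(1)] and Fsg = additive_functorD(2)[OF F sg(1)]
  show "Add C (proj_arr f) (proj_arr g) \<in> Hom C (Dom C (Pepi X M)) (Dom C (Pepi X N))"
    using C.Add_Hom[OF sf(3) sg(3)] .
  show "Pepi X N \<cdot>\<^bsub>C\<^esub> Add C (proj_arr f) (proj_arr g) = Add C f g \<cdot>\<^bsub>C\<^esub> Pepi X M"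
    using C.Cmp_Add[OF sf(3) sg(3) Pepi_Hom[OF N]] C.Add_Cmp[OF Pepi_Hom[OF M] f g] sf(4) sg(4)
    by simp
  show "Add C (syz_arr f) (syz_arr g) \<in> Hom C (syz C X M) (syz C X N)"
    using C.Add_Hom[OF sf(1) sg(1)] .
  show "Pinc X N \<cdot>\<^bsub>C\<^esub> Add C (syz_arr f) (syz_arr g) =
      Add C (proj_arr f) (proj_arr g) \<cdot>\<^bsub>C\<^esub> Pinc X M"
    using C.Cmp_Add[OF sf(1) sg(1) Pinc_Hom[OF N]] C.Add_Cmp[OF Pinc_Hom[OF M] sf(3) sg(3)]
      sf(2) sg(2) by simp
  show "Add D (sat_arr C D X F f) (sat_arr C D X F g) \<in>
      Hom D (sat_obj D X F M) (sat_obj D X F N)"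
    using D.Add_Hom[OF af(1) ag(1)] .
  show "sat_inc X F N \<cdot>\<^bsub>D\<^esub> Add D (sat_arr C D X F f) (sat_arr C D X F g) =
      Arm F (Add C (syz_arr f) (syz_arr g)) \<cdot>\<^bsub>D\<^esub> sat_inc X F M"
    using D.Cmp_Add[OF af(1) ag(1) sat_inc_Hom[OF F N]] D.Add_Cmp[OF sat_inc_Hom[OF F M] Fsf Fsg]
      additive_functorD(5)[OF F sf(1) sg(1)] af(2) ag(2) by simp
qed

lemma additive_functor_sat:
  assumes "additive_functor C D F"
  shows "additive_functor C D (sat C D X F)"
  using sat_obj_Ob[OF assms] sat_arr(1)[OF assms] sat_arr_Idn[OF assms] sat_arr_Cmp[OF assms]
    sat_arr_Add[OF assms]
  unfolding additive_functor_def sat_def by auto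

lemma additive_functor_sat_pow:
  "additive_functor C D F \<Longrightarrow> additive_functor C D (sat_pow C D X k F)"
  by (induction k) (simp_all add: additive_functor_sat)

section \<open>Satellites of natural transformations\<close>

lemma sat_nat_ex1:
  assumes F: "additive_functor C D F" and G: "additive_functor C D G"
    and \<phi>: "nat_trans C D F G \<phi>" and M: "M \<in> Ob C"
  shows "\<exists>!u. u \<in> Hom D (sat_obj D X F M) (sat_obj D X G M) \<and>
    sat_inc X G M \<cdot>\<^bsub>D\<^esub> u = \<phi> (syz C X M) \<cdot>\<^bsub>D\<^esub> sat_inc X F M"
proof -
  note j = Pinc_Hom[OF M] and k = sat_inc_Hom[OF F M]
  note \<phi>K = nat_transD(1)[OF \<phi> syz_Ob[OF M]]
    and \<phi>P = nat_transD(1)[OF \<phi> C.Hom_Ob(1)[OF Pepi_Hom[OF M]]]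
  \<comment> \<open>Naturality of \<open>\<phi>\<close> along \<open>Pinc X M\<close> turns
    vanishing under \<open>F\<close> into vanishing under \<open>G\<close>.\<close>
  have "Arm G (Pinc X M) \<cdot>\<^bsub>D\<^esub> (\<phi> (syz C X M) \<cdot>\<^bsub>D\<^esub> sat_inc X F M) =
      \<phi> (Dom C (Pepi X M)) \<cdot>\<^bsub>D\<^esub> (Arm F (Pinc X M) \<cdot>\<^bsub>D\<^esub> sat_inc X F M)"
    using D.Cmp_assoc[OF k \<phi>K additive_functorD(2)[OF G j]] nat_transD(2)[OF \<phi> j]
      D.Cmp_assoc[OF k additive_functorD(2)[OF F j] \<phi>P] by simp
  then show ?thesis
    using sat_inc_ex1[OF G M D.Cmp_Hom[OF k \<phi>K]] Pinc_sat_inc[OF F M] D.Cmp_Zer[OF \<phi>P]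
      sat_obj_Ob[OF F M] by simp
qed

lemma sat_nat:
  assumes "additive_functor C D F" and "additive_functor C D G"
    and "nat_trans C D F G \<phi>" and "M \<in> Ob C"
  shows "sat_nat C D X F G \<phi> M \<in> Hom D (sat_obj D X F M) (sat_obj D X G M)"
    and "sat_inc X G M \<cdot>\<^bsub>D\<^esub> sat_nat C D X F G \<phi> M = \<phi> (syz C X M) \<cdot>\<^bsub>D\<^esub> sat_inc X F M"
  using theI'[OF sat_nat_ex1[OF assms]] by (simp_all add: sat_nat_def)

text \<open>Both sides may be compared after the monomorphism \<open>sat_inc X G N\<close>; there
  they become \<open>\<phi>\<close> at the syzygies, where naturality along \<open>syz_arr f\<close>
  applies.\<close>

lemma nat_trans_sat_nat:
  assumes F: "additive_functor C D F" and G: "additive_functor C D G"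
    and \<phi>: "nat_trans C D F G \<phi>"
  shows "nat_trans C D (sat C D X F) (sat C D X G) (sat_nat C D X F G \<phi>)"
proof -
  have "sat_nat C D X F G \<phi> N \<cdot>\<^bsub>D\<^esub> sat_arr C D X F f =
      sat_arr C D X G f \<cdot>\<^bsub>D\<^esub> sat_nat C D X F G \<phi> M" if f: "f \<in> Hom C M N" for M N f
  proof -
    note M = C.Hom_Ob(1)[OF f] and N = C.Hom_Ob(2)[OF f] and s = syz_arr(1)[OF f]
    note aF = sat_arr[OF F f] and aG = sat_arr[OF G f]
    note nM = sat_nat[OF F G \<phi> M] and nN = sat_nat[OF F G \<phi> N]
    note iM = sat_inc_Hom[OF F M] and jM = sat_inc_Hom[OF G M]
      and iN = sat_inc_Hom[OF F N] and jN = sat_inc_Hom[OF G N]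
    note \<phi>M = nat_transD(1)[OF \<phi> syz_Ob[OF M]] and \<phi>N = nat_transD(1)[OF \<phi> syz_Ob[OF N]]
    note Fs = additive_functorD(2)[OF F s] and Gs = additive_functorD(2)[OF G s]
    have "sat_inc X G N \<cdot>\<^bsub>D\<^esub> (sat_nat C D X F G \<phi> N \<cdot>\<^bsub>D\<^esub> sat_arr C D X F f) =
        \<phi> (syz C X N) \<cdot>\<^bsub>D\<^esub> (Arm F (syz_arr f) \<cdot>\<^bsub>D\<^esub> sat_inc X F M)"
      using D.Cmp_assoc[OF aF(1) nN(1) jN] D.Cmp_assoc[OF aF(1) iN \<phi>N] nN(2) aF(2) by simp
    also have "\<dots> = Arm G (syz_arr f) \<cdot>\<^bsub>D\<^esub> (\<phi> (syz C X M) \<cdot>\<^bsub>D\<^esub> sat_inc X F M)"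
      using D.Cmp_assoc[OF iM Fs \<phi>N] D.Cmp_assoc[OF iM \<phi>M Gs] nat_transD(2)[OF \<phi> s] by simp
    also have "\<dots> = sat_inc X G N \<cdot>\<^bsub>D\<^esub> (sat_arr C D X G f \<cdot>\<^bsub>D\<^esub> sat_nat C D X F G \<phi> M)"
      using D.Cmp_assoc[OF nM(1) jM Gs] D.Cmp_assoc[OF nM(1) aG(1) jN] nM(2) aG(2) by simp
    finally show ?thesis
      using sat_inc_cancel[OF G N D.Cmp_Hom[OF aF(1) nN(1)] D.Cmp_Hom[OF nM(1) aG(1)]] by simp
  qed
  then show ?thesis
    using sat_nat(1)[OF F G \<phi>] unfolding nat_trans_def sat_def by simp
qed

lemma nat_trans_sat_nat_pow:
  assumes F: "additive_functor C D F" and G: "additive_functor C D G"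
    and \<phi>: "nat_trans C D F G \<phi>"
  shows "nat_trans C D (sat_pow C D X k F) (sat_pow C D X k G) (sat_nat_pow C D X k F G \<phi>)"
  by (induction k)
    (simp_all add: \<phi> nat_trans_sat_nat additive_functor_sat_pow[OF F] additive_functor_sat_pow[OF G])

text \<open>\<open>sat_pow\<close> adds satellites on the outside, whereas the \<open>k\<close>-th
  satellite of \<open>udel\<close> ends in \<open>k\<close> satellites of a functor
  \<open>sat C D X F\<close>. Iterates of one operation agree literally, so no comparison
  isomorphism enters.\<close>

lemma sat_pow_sat: "sat_pow C D X k (sat C D X F) = sat_pow C D X (Suc k) F"
  by (induction k) simp_all

section \<open>Connecting homomorphisms of satellites\<close>

lemma sat_con_sat: "sat_con C D X k (sat C D X F) i p = sat_con C D X (Suc k) F i p"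
  unfolding sat_con_def sat_pow_sat ..

lemma syz_lift_Idn:
  assumes "short_exact C i p"
  shows "syz_lift C X i p (Idn C (Cod C p)) \<in> Hom C (syz C X (Cod C p)) (Dom C i)"
  using syz_lift(1)[OF assms C.Idn_Hom] C.Hom_Ob(2)[OF short_exact_Hom(2)[OF assms]] by blast

lemma sat_con_Hom:
  assumes F: "additive_functor C D F" and ip: "short_exact C i p"
  shows "sat_con C D X k F i p \<in>
    Hom D (Obm (sat_pow C D X (Suc k) F) (Cod C p)) (Obm (sat_pow C D X k F) (Dom C i))"
proof -
  note Fk = additive_functor_sat_pow[OF F, of k]
  show ?thesis
    using D.Cmp_Hom[OF sat_inc_Hom[OF Fk C.Hom_Ob(2)[OF short_exact_Hom(2)[OF ip]]]
        additive_functorD(2)[OF Fk syz_lift_Idn[OF ip]]]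
    by (simp add: sat_con_def sat_def)
qed

text \<open>A satellite of a transformation is its restriction at the syzygy, and what remains is
  naturality along the lift into \<open>Dom C i\<close>. With \<open>udel\<close> for
  \<open>\<phi>\<close> this gives compatibility of the transition maps with \<epsilon> below the
  cut-off degree.\<close>

lemma sat_con_natural:
  assumes F: "additive_functor C D F" and G: "additive_functor C D G"
    and \<phi>: "nat_trans C D F G \<phi>" and ip: "short_exact C i p"
  shows "sat_nat_pow C D X k F G \<phi> (Dom C i) \<cdot>\<^bsub>D\<^esub> sat_con C D X k F i p =
    sat_con C D X k G i p \<cdot>\<^bsub>D\<^esub> sat_nat_pow C D X (Suc k) F G \<phi> (Cod C p)"
proof -
  let ?F = "sat_pow C D X k F" and ?G = "sat_pow C D X k G"
    and ?\<phi> = "sat_nat_pow C D X k F G \<phi>" and ?M = "Cod C p"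
  note M = C.Hom_Ob(2)[OF short_exact_Hom(2)[OF ip]] and u = syz_lift_Idn[OF ip]
  note F' = additive_functor_sat_pow[OF F, of k] and G' = additive_functor_sat_pow[OF G, of k]
  note \<phi>' = nat_trans_sat_nat_pow[OF F G \<phi>, of k]
  note Fu = additive_functorD(2)[OF F' u] and Gu = additive_functorD(2)[OF G' u]
  note n = sat_nat[OF F' G' \<phi>' M]
  note \<phi>K = nat_transD(1)[OF \<phi>' syz_Ob[OF M]]
    and \<phi>i = nat_transD(1)[OF \<phi>' C.Hom_Ob(1)[OF short_exact_Hom(1)[OF ip]]]
  note iF = sat_inc_Hom[OF F' M] and iG = sat_inc_Hom[OF G' M]
  show ?thesis
    using D.Cmp_assoc[OF iF Fu \<phi>i] D.Cmp_assoc[OF iF \<phi>K Gu] nat_transD(2)[OF \<phi>' u]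
      D.Cmp_assoc[OF n(1) iG Gu] n(2)
    by (simp add: sat_con_def)
qed

text \<open>The lift of the identity picked here need not be an identity, but it is
  \<open>syz_arr (Idn C M)\<close>, whose effect on the kernel is trivial by
  \<open>sat_arr_Idn\<close>.\<close>

lemma sat_con_resolution:
  assumes F: "additive_functor C D F" and M: "M \<in> Ob C"
  shows "sat_con C D X k F (Pinc X M) (Pepi X M) = sat_inc X (sat_pow C D X k F) M"
proof -
  note Fk = additive_functor_sat_pow[OF F, of k]
  have cod: "Cod C (Idn C M) = M"
    using C.Idn_Hom[OF M] by (simp add: Hom_def)
  have "sat_con C D X k F (Pinc X M) (Pepi X M) =
      sat_inc X (sat_pow C D X k F) M \<cdot>\<^bsub>D\<^esub> sat_arr C D X (sat_pow C D X k F) (Idn C M)"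
    using sat_arr(2)[OF Fk C.Idn_Hom[OF M]] cod
    by (simp add: sat_con_def syz_arr_def resolution(2)[OF M])
  then show ?thesis
    using D.Cmp_Idn[OF sat_inc_Hom[OF Fk M]] sat_arr_Idn[OF Fk M] by simp
qed

end

section \<open>Sequences and cofinality\<close>

context category
begin

section \<open>Composites along a sequence of arrows\<close>

lemma chain_Hom:
  assumes x: "\<And>j. x j \<in> Ob C" and s: "\<And>j. s j \<in> Hom C (x j) (x (Suc j))"
  shows "chain C x s k d \<in> Hom C (x k) (x (k + d))"
proof (induction d)
  case 0
  then show ?case
    using Idn_Hom[OF x] by simp
next
  case (Suc d)
  then show ?case
    using Cmp_Hom[OF Suc.IH s] by simp
qed

lemma chain_add:
  assumes x: "\<And>j. x j \<in> Ob C" and s: "\<And>j. s j \<in> Hom C (x j) (x (Suc j))"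
  shows "chain C x s (k + d) e \<cdot>\<^bsub>C\<^esub> chain C x s k d = chain C x s k (d + e)"
proof (induction e)
  case 0
  then show ?case
    using Idn_Cmp[OF chain_Hom[where x = x and s = s, OF x s]] by simp
next
  case (Suc e)
  then show ?case
    using Cmp_assoc[OF chain_Hom[where x = x and s = s, OF x s, of k d]
        chain_Hom[where x = x and s = s, OF x s, of "k + d" e] s]
    by (simp add: add.assoc)
qed

lemma chain_natural:
  assumes x: "\<And>j. x j \<in> Ob C" and s: "\<And>j. s j \<in> Hom C (x j) (x (Suc j))"
    and y: "\<And>j. y j \<in> Ob C" and r: "\<And>j. r j \<in> Hom C (y j) (y (Suc j))"
    and t: "\<And>j. t j \<in> Hom C (x j) (y j)"
    and eq: "\<And>j. r j \<cdot>\<^bsub>C\<^esub> t j = t (Suc j) \<cdot>\<^bsub>C\<^esub> s j"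
  shows "chain C y r k d \<cdot>\<^bsub>C\<^esub> t k = t (k + d) \<cdot>\<^bsub>C\<^esub> chain C x s k d"
proof (induction d)
  case 0
  then show ?case
    using Idn_Cmp[OF t] Cmp_Idn[OF t] by simp
next
  case (Suc d)
  have "chain C y r k (Suc d) \<cdot>\<^bsub>C\<^esub> t k = r (k + d) \<cdot>\<^bsub>C\<^esub> (t (k + d) \<cdot>\<^bsub>C\<^esub> chain C x s k d)"
    using Cmp_assoc[OF t chain_Hom[where x = y and s = r, OF y r] r] Suc by simp
  also have "\<dots> = (t (Suc (k + d)) \<cdot>\<^bsub>C\<^esub> s (k + d)) \<cdot>\<^bsub>C\<^esub> chain C x s k d"
    using Cmp_assoc[OF chain_Hom[where x = x and s = s, OF x s] t r] eq by simp
  also have "\<dots> = t (k + Suc d) \<cdot>\<^bsub>C\<^esub> chain C x s k (Suc d)"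
    using Cmp_assoc[OF chain_Hom[where x = x and s = s, OF x s] s t] by simp
  finally show ?case .
qed

section \<open>Maps between direct limits\<close>

lemma direct_limit_map_ex1:
  assumes L: "is_direct_limit C I rel ob tr L leg" and L': "is_direct_limit C I rel ob' tr' L' leg'"
    and u: "direct_system_map C I rel ob tr ob' tr' u"
  shows "\<exists>!w. w \<in> Hom C L L' \<and> (\<forall>i\<in>I. w \<cdot>\<^bsub>C\<^esub> leg i = leg' i \<cdot>\<^bsub>C\<^esub> u i)"
proof -
  have tr: "tr i j \<in> Hom C (ob i) (ob j)" if "i \<in> I" "j \<in> I" "rel i j" for i j
    using L that by (simp add: is_direct_limit_def direct_system_def)
  have tr': "tr' i j \<in> Hom C (ob' i) (ob' j)" if "i \<in> I" "j \<in> I" "rel i j" for i j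
    using L' that by (simp add: is_direct_limit_def direct_system_def)
  have leg': "leg' i \<in> Hom C (ob' i) L'" if "i \<in> I" for i
    using L' that by (simp add: is_direct_limit_def cocone_def)
  have u_Hom: "u i \<in> Hom C (ob i) (ob' i)" if "i \<in> I" for i
    using u that by (simp add: direct_system_map_def)
  have "(leg' j \<cdot>\<^bsub>C\<^esub> u j) \<cdot>\<^bsub>C\<^esub> tr i j = leg' i \<cdot>\<^bsub>C\<^esub> u i" if ij: "i \<in> I" "j \<in> I" "rel i j" for i j
  proof -
    have "(leg' j \<cdot>\<^bsub>C\<^esub> u j) \<cdot>\<^bsub>C\<^esub> tr i j = leg' j \<cdot>\<^bsub>C\<^esub> (tr' i j \<cdot>\<^bsub>C\<^esub> u i)"
      using Cmp_assoc[OF tr[OF ij] u_Hom leg'] u ij by (simp add: direct_system_map_def)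
    also have "\<dots> = leg' i \<cdot>\<^bsub>C\<^esub> u i"
      using Cmp_assoc[OF u_Hom tr'[OF ij] leg'] L' ij by (simp add: is_direct_limit_def cocone_def)
    finally show ?thesis .
  qed
  moreover have "leg' i \<cdot>\<^bsub>C\<^esub> u i \<in> Hom C (ob i) L'" if "i \<in> I" for i
    using Cmp_Hom[OF u_Hom[OF that] leg'[OF that]] .
  \<comment> \<open>The arrows \<open>u\<close> followed by the legs of the target form a cocone on
    the source system; its mediating arrow is the limit map.\<close>
  ultimately have "cocone C I rel ob tr L' (\<lambda>i. leg' i \<cdot>\<^bsub>C\<^esub> u i)"
    using L' by (simp add: is_direct_limit_def cocone_def)
  with L show ?thesis
    by (auto simp: is_direct_limit_def)
qed

lemma direct_limit_mapI:
  assumes "is_direct_limit C I rel ob tr L leg" and "is_direct_limit C I rel ob' tr' L' leg'"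
    and "direct_system_map C I rel ob tr ob' tr' u"
    and "w \<in> Hom C L L'" and "\<And>i. i \<in> I \<Longrightarrow> w \<cdot>\<^bsub>C\<^esub> leg i = leg' i \<cdot>\<^bsub>C\<^esub> u i"
  shows "is_direct_limit_map C I L leg L' leg' u w"
  using direct_limit_map_ex1[OF assms(1-3)] assms(4,5) unfolding is_direct_limit_map_def by blast

text \<open>Uniqueness is built into \<open>is_direct_limit_map\<close>, so one existing limit map
  already settles the \<open>THE\<close> in \<open>hat_arr\<close>.\<close>

lemma the_direct_limit_map:
  assumes "is_direct_limit C I rel ob tr L leg" and "is_direct_limit C I rel ob' tr' L' leg'"
    and "direct_system_map C I rel ob tr ob' tr' u"
  shows "is_direct_limit_map C I L leg L' leg' u (THE w. is_direct_limit_map C I L leg L' leg' u w)"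
proof -
  obtain w where "w \<in> Hom C L L'" "\<forall>i\<in>I. w \<cdot>\<^bsub>C\<^esub> leg i = leg' i \<cdot>\<^bsub>C\<^esub> u i"
    using direct_limit_map_ex1[OF assms] by blast
  then have w: "is_direct_limit_map C I L leg L' leg' u w"
    by (intro direct_limit_mapI[OF assms]) simp_all
  then have "(THE w. is_direct_limit_map C I L leg L' leg' u w) = w"
    by (intro the_equality) (auto simp: is_direct_limit_map_def)
  with w show ?thesis
    by simp
qed

text \<open>The last premise combines cofinality of \<open>\<kappa>\<close> with the shape of the
  legs: move forward into the image of \<open>\<kappa>\<close>, then apply \<open>leg'\<close>. The
  set \<open>J\<close> is left open to cover the whole sequence and its tails alike.\<close>

lemma is_direct_limit_cofinal:
  fixes \<kappa> :: "'i::linorder \<Rightarrow> 'j::linorder"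
  assumes L: "is_direct_limit C UNIV (\<le>) ob' tr' L leg'" and S: "direct_system C J (\<le>) ob tr"
    and \<kappa>: "mono \<kappa>" and \<kappa>J: "\<And>m. \<kappa> m \<in> J"
    and ob': "\<And>m. ob' m = ob (\<kappa> m)"
    and tr': "\<And>m m'. m \<le> m' \<Longrightarrow> tr' m m' = tr (\<kappa> m) (\<kappa> m')"
    and leg: "\<And>k. k \<in> J \<Longrightarrow> \<exists>m. k \<le> \<kappa> m \<and> leg k = leg' m \<cdot>\<^bsub>C\<^esub> tr k (\<kappa> m)"
  shows "is_direct_limit C J (\<le>) ob tr L leg"
proof -
  have tr: "tr k l \<in> Hom C (ob k) (ob l)" if "k \<in> J" "l \<in> J" "k \<le> l" for k l
    using S that by (simp add: direct_system_def)
  have tr_Cmp: "tr l q \<cdot>\<^bsub>C\<^esub> tr k l = tr k q"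
    if "k \<in> J" "l \<in> J" "q \<in> J" "k \<le> l" "l \<le> q" for k l q
    using S that unfolding direct_system_def by blast
  have tr_Idn: "tr k k = Idn C (ob k)" if "k \<in> J" for k
    using S that by (simp add: direct_system_def)
  have leg': "leg' m \<in> Hom C (ob (\<kappa> m)) L" for m
    using L ob' by (simp add: is_direct_limit_def cocone_def)
  have leg'_tr: "leg' m' \<cdot>\<^bsub>C\<^esub> tr (\<kappa> m) (\<kappa> m') = leg' m" if "m \<le> m'" for m m'
    using L tr' that by (simp add: is_direct_limit_def cocone_def)
  have advance: "leg' m \<cdot>\<^bsub>C\<^esub> tr k (\<kappa> m) = leg' m' \<cdot>\<^bsub>C\<^esub> tr k (\<kappa> m')"
    if k: "k \<in> J" "k \<le> \<kappa> m" and m: "m \<le> m'" for k m m'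
    using Cmp_assoc[OF tr[OF k(1) \<kappa>J k(2)] tr[OF \<kappa>J \<kappa>J monoD[OF \<kappa> m]] leg']
      leg'_tr[OF m] tr_Cmp[OF k(1) \<kappa>J \<kappa>J k(2) monoD[OF \<kappa> m]] by simp
  have leg_eq: "leg k = leg' m \<cdot>\<^bsub>C\<^esub> tr k (\<kappa> m)" if k: "k \<in> J" "k \<le> \<kappa> m" for k m
  proof -
    obtain m' where m': "k \<le> \<kappa> m'" "leg k = leg' m' \<cdot>\<^bsub>C\<^esub> tr k (\<kappa> m')"
      using leg[OF k(1)] by blast
    \<comment> \<open>The premise provides only some \<open>m'\<close>; both indices are advanced to
      their maximum, which changes neither composite.\<close>
    show ?thesis
      using advance[OF k, of "max m m'"] advance[OF k(1) m'(1), of "max m m'"] m'(2) by simp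
  qed
  \<comment> \<open>At an index in the image of \<open>\<kappa>\<close> the forward arrow is an
    identity, so \<open>leg\<close> extends \<open>leg'\<close>.\<close>
  have leg_\<kappa>: "leg (\<kappa> m) = leg' m" for m
    using leg_eq[OF \<kappa>J order_refl] tr_Idn[OF \<kappa>J] Cmp_Idn[OF leg'] by simp
  have leg_Hom: "leg k \<in> Hom C (ob k) L" if k: "k \<in> J" for k
    using leg[OF k] Cmp_Hom[OF tr[OF k \<kappa>J] leg'] by auto
  have "leg l \<cdot>\<^bsub>C\<^esub> tr k l = leg k" if kl: "k \<in> J" "l \<in> J" "k \<le> l" for k l
  proof -
    obtain m where m: "l \<le> \<kappa> m"
      using leg[OF kl(2)] by blast
    show ?thesis
      using leg_eq[OF kl(2) m] leg_eq[OF kl(1) order_trans[OF kl(3) m]]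
        Cmp_assoc[OF tr[OF kl] tr[OF kl(2) \<kappa>J m] leg'] tr_Cmp[OF kl(1,2) \<kappa>J kl(3) m] by simp
  qed
  then have coc: "cocone C J (\<le>) ob tr L leg"
    using L leg_Hom by (simp add: is_direct_limit_def cocone_def)
  have "\<exists>!w. w \<in> Hom C L Y \<and> (\<forall>k\<in>J. w \<cdot>\<^bsub>C\<^esub> leg k = g k)" if g: "cocone C J (\<le>) ob tr Y g" for Y g
  proof -
    have "cocone C UNIV (\<le>) ob' tr' Y (\<lambda>m. g (\<kappa> m))"
      using g \<kappa>J monoD[OF \<kappa>] by (simp add: cocone_def ob' tr')
    then have "\<exists>!w. w \<in> Hom C L Y \<and> (\<forall>m. w \<cdot>\<^bsub>C\<^esub> leg' m = g (\<kappa> m))"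
      using L by (simp add: is_direct_limit_def)
    \<comment> \<open>Compatibility with a cocone on \<open>J\<close> is decided on the image of
      \<open>\<kappa>\<close>, so unique existence passes from the reindexed system to the whole
      one.\<close>
    moreover have "(\<forall>m. w \<cdot>\<^bsub>C\<^esub> leg' m = g (\<kappa> m)) \<longleftrightarrow> (\<forall>k\<in>J. w \<cdot>\<^bsub>C\<^esub> leg k = g k)"
      if w: "w \<in> Hom C L Y" for w
    proof
      assume eq: "\<forall>m. w \<cdot>\<^bsub>C\<^esub> leg' m = g (\<kappa> m)"
      show "\<forall>k\<in>J. w \<cdot>\<^bsub>C\<^esub> leg k = g k"
      proof
        fix k
        assume k: "k \<in> J"
        obtain m where m: "k \<le> \<kappa> m" "leg k = leg' m \<cdot>\<^bsub>C\<^esub> tr k (\<kappa> m)"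
          using leg[OF k] by blast
        have "w \<cdot>\<^bsub>C\<^esub> leg k = g (\<kappa> m) \<cdot>\<^bsub>C\<^esub> tr k (\<kappa> m)"
          using Cmp_assoc[OF tr[OF k \<kappa>J m(1)] leg' w] m(2) eq by simp
        also have "\<dots> = g k"
          using g k \<kappa>J m(1) by (simp add: cocone_def)
        finally show "w \<cdot>\<^bsub>C\<^esub> leg k = g k" .
      qed
    qed (metis leg_\<kappa> \<kappa>J)
    ultimately show ?thesis
      by blast
  qed
  with S coc show ?thesis
    by (simp add: is_direct_limit_def)
qed

end


section \<open>The satellite functor construction\<close>

locale cohomological_satellites = satellites C D X
  for C :: "('oc, 'ac) cat" and D :: "('od, 'ad) cat" and X :: "('oc, 'ac, 'od, 'ad) choices" +
  fixes T :: "('oc, 'ac, 'od, 'ad) cohf"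
  assumes cohomological: "cohomological_functor C D T"
begin

section \<open>Connecting homomorphisms of the given functor\<close>

lemma additive: "additive_functor C D (Deg T n)"
  using cohomological by (simp add: cohomological_functor_def)

lemma Con_Hom:
  "short_exact C i p \<Longrightarrow>
    Con T n i p \<in> Hom D (Obm (Deg T n) (Cod C p)) (Obm (Deg T (n + 1)) (Dom C i))"
  using cohomological by (simp add: cohomological_functor_def)

lemma Con_natural:
  assumes "short_exact C i p" and "short_exact C i' p'"
    and "a \<in> Hom C (Dom C i) (Dom C i')" and "b \<in> Hom C (Cod C i) (Cod C i')"
    and "c \<in> Hom C (Cod C p) (Cod C p')"
    and "b \<cdot>\<^bsub>C\<^esub> i = i' \<cdot>\<^bsub>C\<^esub> a" and "c \<cdot>\<^bsub>C\<^esub> p = p' \<cdot>\<^bsub>C\<^esub> b"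
  shows "Arm (Deg T (n + 1)) a \<cdot>\<^bsub>D\<^esub> Con T n i p = Con T n i' p' \<cdot>\<^bsub>D\<^esub> Arm (Deg T n) c"
  using cohomological assms unfolding cohomological_functor_def by metis

lemma Con_exact: "short_exact C i p \<Longrightarrow> exact_pair D (Con T n i p) (Arm (Deg T (n + 1)) i)"
  using cohomological by (simp add: cohomological_functor_def)

text \<open>The induced arrow, the lift and \<open>f\<close> form a morphism from the chosen
  sequence of \<open>M\<close> to the given one, to which naturality applies. With \<open>f\<close>
  an identity, every connecting homomorphism is expressed through that of a chosen sequence.\<close>

lemma Con_syz_lift:
  assumes ip: "short_exact C i p" and f: "f \<in> Hom C M (Cod C p)"
  shows "Arm (Deg T (n + 1)) (syz_lift C X i p f) \<cdot>\<^bsub>D\<^esub> Con T n (Pinc X M) (Pepi X M) =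
    Con T n i p \<cdot>\<^bsub>D\<^esub> Arm (Deg T n) f"
proof -
  note M = C.Hom_Ob(1)[OF f]
  have "Cod C (Pinc X M) = Dom C (Pepi X M)" "Cod C i = Dom C p"
    using Pinc_Hom[OF M] short_exact_Hom[OF ip] by (simp_all add: Hom_def)
  then show ?thesis
    using Con_natural[OF resolution(1)[OF M] ip, of "syz_lift C X i p f" "proj_lift C X p f" f]
      syz_lift[OF ip f] proj_lift[OF ip f] f resolution(2)[OF M] by (simp add: syz_def)
qed

lemma Con_resolution_Hom:
  assumes M: "M \<in> Ob C"
  shows "Con T n (Pinc X M) (Pepi X M) \<in> Hom D (Obm (Deg T n) M) (Obm (Deg T (n + 1)) (syz C X M))"
  using Con_Hom[OF resolution(1)[OF M]] resolution(2)[OF M] by (simp add: syz_def)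

text \<open>Exactness at the value on the syzygy shows that the connecting homomorphism is killed by
  the image of \<open>Pinc X M\<close>, so it factors uniquely through the kernel.\<close>

lemma udel:
  assumes M: "M \<in> Ob C"
  shows "udel D X T n M \<in> Hom D (Obm (Deg T n) M) (sat_obj D X (Deg T (n + 1)) M)"
    and "sat_inc X (Deg T (n + 1)) M \<cdot>\<^bsub>D\<^esub> udel D X T n M = Con T n (Pinc X M) (Pepi X M)"
proof -
  have "Arm (Deg T (n + 1)) (Pinc X M) \<cdot>\<^bsub>D\<^esub> Con T n (Pinc X M) (Pepi X M) =
      Zer D (Obm (Deg T n) M) (Obm (Deg T (n + 1)) (Dom C (Pepi X M)))"
    using D.exact_pair_Cmp[OF Con_exact[OF resolution(1)[OF M]] Con_resolution_Hom[OF M]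
        additive_functorD(2)[OF additive Pinc_Hom[OF M]]] .
  from theI'[OF sat_inc_ex1[OF additive M Con_resolution_Hom[OF M] this]]
  show "udel D X T n M \<in> Hom D (Obm (Deg T n) M) (sat_obj D X (Deg T (n + 1)) M)"
    and "sat_inc X (Deg T (n + 1)) M \<cdot>\<^bsub>D\<^esub> udel D X T n M = Con T n (Pinc X M) (Pepi X M)"
    unfolding udel_def by simp_all
qed

text \<open>Tested after the monomorphism \<open>sat_inc\<close>, this becomes naturality of the
  connecting homomorphisms of two chosen sequences along a lift of \<open>f\<close>.\<close>

lemma nat_trans_udel: "nat_trans C D (Deg T n) (sat C D X (Deg T (n + 1))) (udel D X T n)"
proof -
  let ?S = "Deg T (n + 1)"
  have "udel D X T n N \<cdot>\<^bsub>D\<^esub> Arm (Deg T n) f = sat_arr C D X ?S f \<cdot>\<^bsub>D\<^esub> udel D X T n M"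
    if f: "f \<in> Hom C M N" for M N f
  proof -
    note M = C.Hom_Ob(1)[OF f] and N = C.Hom_Ob(2)[OF f]
    note Tf = additive_functorD(2)[OF additive[of n] f]
      and Ss = additive_functorD(2)[OF additive[of "n + 1"] syz_arr(1)[OF f]]
    note uM = udel[OF M, of n] and uN = udel[OF N, of n]
      and iM = sat_inc_Hom[OF additive[of "n + 1"] M] and iN = sat_inc_Hom[OF additive[of "n + 1"] N]
      and a = sat_arr[OF additive[of "n + 1"] f]
    have "sat_inc X ?S N \<cdot>\<^bsub>D\<^esub> (udel D X T n N \<cdot>\<^bsub>D\<^esub> Arm (Deg T n) f) =
        Con T n (Pinc X N) (Pepi X N) \<cdot>\<^bsub>D\<^esub> Arm (Deg T n) f"
      using D.Cmp_assoc[OF Tf uN(1) iN] uN(2) by simp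
    also have "\<dots> = Arm ?S (syz_arr f) \<cdot>\<^bsub>D\<^esub> Con T n (Pinc X M) (Pepi X M)"
    proof -
      have "f \<in> Hom C M (Cod C (Pepi X N))" "Cod C f = N"
        using f resolution(2)[OF N] by (simp_all add: Hom_def)
      then show ?thesis
        using Con_syz_lift[OF resolution(1)[OF N]] by (simp add: syz_arr_def)
    qed
    also have "\<dots> = sat_inc X ?S N \<cdot>\<^bsub>D\<^esub> (sat_arr C D X ?S f \<cdot>\<^bsub>D\<^esub> udel D X T n M)"
      using D.Cmp_assoc[OF uM(1) a(1) iN] D.Cmp_assoc[OF uM(1) iM Ss] a(2) uM(2) by simp
    finally show ?thesis
      using sat_inc_cancel[OF additive N D.Cmp_Hom[OF Tf uN(1)] D.Cmp_Hom[OF uM(1) a(1)]] by simp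
  qed
  then show ?thesis
    using udel(1) unfolding nat_trans_def sat_def by simp
qed

text \<open>Needed at the one degree where raising the cut-off replaces a connecting homomorphism of
  \<open>T\<close> by \<epsilon>; it is \<open>Con_syz_lift\<close> for the identity.\<close>

lemma sat_con_udel:
  assumes ip: "short_exact C i p"
  shows "sat_con C D X 0 (Deg T (n + 1)) i p \<cdot>\<^bsub>D\<^esub> udel D X T n (Cod C p) = Con T n i p"
proof -
  note M = C.Hom_Ob(2)[OF short_exact_Hom(2)[OF ip]]
  note u = udel[OF M, of n]
  have "Con T n i p \<cdot>\<^bsub>D\<^esub> Arm (Deg T n) (Idn C (Cod C p)) = Con T n i p"
    using additive_functorD(3)[OF additive M] D.Cmp_Idn[OF Con_Hom[OF ip]] by simp
  then show ?thesis
    using Con_syz_lift[OF ip C.Idn_Hom[OF M], of n] u(2)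
      D.Cmp_assoc[OF u(1) sat_inc_Hom[OF additive M]
        additive_functorD(2)[OF additive syz_lift_Idn[OF ip]]]
    by (simp add: sat_con_def)
qed

section \<open>The sequence of satellites in a fixed degree\<close>

lemma additive_sat_seq: "additive_functor C D (sat_seq C D X T n k)"
  unfolding sat_seq_def by (rule additive_functor_sat_pow[OF additive])

lemma sat_seq_Suc:
  "sat_seq C D X T n (Suc k) = sat_pow C D X k (sat C D X (Deg T (n + int k + 1)))"
  by (simp add: sat_seq_def sat_pow_sat algebra_simps)

lemma nat_trans_sat_seq_step:
  "nat_trans C D (sat_seq C D X T n k) (sat_seq C D X T n (Suc k)) (sat_seq_step C D X T n k)"
  unfolding sat_seq_Suc sat_seq_step_def
  unfolding sat_seq_def
  by (rule nat_trans_sat_nat_pow[OF additive additive_functor_sat[OF additive] nat_trans_udel])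

lemma sat_seq_Ob: "M \<in> Ob C \<Longrightarrow> Obm (sat_seq C D X T n k) M \<in> Ob D"
  using additive_functorD(1)[OF additive_sat_seq] .

lemma sat_seq_step_Hom:
  "M \<in> Ob C \<Longrightarrow> sat_seq_step C D X T n k M \<in>
    Hom D (Obm (sat_seq C D X T n k) M) (Obm (sat_seq C D X T n (Suc k)) M)"
  using nat_transD(1)[OF nat_trans_sat_seq_step] .

lemma sat_seq_tr_Idn: "sat_seq_tr C D X T n M k k = Idn D (Obm (sat_seq C D X T n k) M)"
  by (simp add: sat_seq_tr_def)

lemma sat_seq_tr_Suc:
  "M \<in> Ob C \<Longrightarrow> sat_seq_tr C D X T n M k (Suc k) = sat_seq_step C D X T n k M"
  using D.Cmp_Idn[OF sat_seq_step_Hom] by (simp add: sat_seq_tr_def Suc_diff_le)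

lemma sat_seq_tr_Cmp:
  assumes M: "M \<in> Ob C" and "k \<le> l" and "l \<le> q"
  shows "sat_seq_tr C D X T n M l q \<cdot>\<^bsub>D\<^esub> sat_seq_tr C D X T n M k l = sat_seq_tr C D X T n M k q"
  using D.chain_add[where x = "\<lambda>k. Obm (sat_seq C D X T n k) M"
      and s = "\<lambda>k. sat_seq_step C D X T n k M", OF sat_seq_Ob[OF M] sat_seq_step_Hom[OF M], of k "l - k" "q - l"] assms(2,3)
  by (simp add: sat_seq_tr_def)

lemma nat_trans_sat_seq_tr:
  assumes "k \<le> l"
  shows "nat_trans C D (sat_seq C D X T n k) (sat_seq C D X T n l)
    (\<lambda>M. sat_seq_tr C D X T n M k l)"
  unfolding nat_trans_def
proof (intro conjI ballI allI)
  fix M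
  assume M: "M \<in> Ob C"
  show "sat_seq_tr C D X T n M k l \<in>
      Hom D (Obm (sat_seq C D X T n k) M) (Obm (sat_seq C D X T n l) M)"
    using D.chain_Hom[where x = "\<lambda>k. Obm (sat_seq C D X T n k) M"
      and s = "\<lambda>k. sat_seq_step C D X T n k M", OF sat_seq_Ob[OF M] sat_seq_step_Hom[OF M], of k "l - k"] assms
    by (simp add: sat_seq_tr_def)
next
  fix M N f
  assume f: "f \<in> Hom C M N"
  note M = C.Hom_Ob(1)[OF f] and N = C.Hom_Ob(2)[OF f]
  show "sat_seq_tr C D X T n N k l \<cdot>\<^bsub>D\<^esub> Arm (sat_seq C D X T n k) f =
      Arm (sat_seq C D X T n l) f \<cdot>\<^bsub>D\<^esub> sat_seq_tr C D X T n M k l"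
    using D.chain_natural[where x = "\<lambda>k. Obm (sat_seq C D X T n k) M"
        and s = "\<lambda>k. sat_seq_step C D X T n k M" and y = "\<lambda>k. Obm (sat_seq C D X T n k) N"
        and r = "\<lambda>k. sat_seq_step C D X T n k N" and t = "\<lambda>k. Arm (sat_seq C D X T n k) f",
        OF sat_seq_Ob[OF M] sat_seq_step_Hom[OF M] sat_seq_Ob[OF N] sat_seq_step_Hom[OF N]
          additive_functorD(2)[OF additive_sat_seq f] nat_transD(2)[OF nat_trans_sat_seq_step f],
        of k "l - k"] assms
    by (simp add: sat_seq_tr_def)
qed

lemma direct_system_sat_seq:
  assumes "M \<in> Ob C"
  shows "direct_system D J (\<le>) (\<lambda>k. Obm (sat_seq C D X T n k) M) (sat_seq_tr C D X T n M)"
  using sat_seq_Ob[OF assms] nat_transD(1)[OF nat_trans_sat_seq_tr assms] sat_seq_tr_Idn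
    sat_seq_tr_Cmp[OF assms]
  by (simp add: direct_system_def)

section \<open>The truncations and their transition morphisms\<close>

lemma Deg_trunc: "Deg (trunc C D X T m) n = sat_seq C D X T n (nat (int m - n))"
  \<comment> \<open>The cut-off in \<open>nat\<close> merges both branches: for \<open>m\<close> at
    most \<open>n\<close> the index is 0 and the term is \<open>Deg T n\<close>; otherwise it is
    \<open>m - n\<close>, and the underlying degree is \<open>m\<close>.\<close>
  by (cases "int m \<le> n") (simp_all add: trunc_def sat_seq_def)

lemma Con_trunc_ge: "int m \<le> n \<Longrightarrow> Con (trunc C D X T m) n i p = Con T n i p"
  by (simp add: trunc_def)

lemma Con_trunc_less:
  "n < int m \<Longrightarrow>
    Con (trunc C D X T m) n i p = sat_con C D X (nat (int m - n - 1)) (Deg T (int m)) i p"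
  by (simp add: trunc_def)

lemma Con_trunc_Hom:
  assumes ip: "short_exact C i p"
  shows "Con (trunc C D X T m) n i p \<in> Hom D (Obm (Deg (trunc C D X T m) n) (Cod C p))
    (Obm (Deg (trunc C D X T m) (n + 1)) (Dom C i))"
proof (cases "int m \<le> n")
  case True
  then show ?thesis
    using Con_Hom[OF ip] by (simp add: trunc_def)
next
  case False
  \<comment> \<open>Below the cut-off, degree \<open>n\<close> is satellite \<open>k + 1\<close> and
    degree \<open>n + 1\<close> is satellite \<open>k\<close> of the same functor
    \<open>Deg T m\<close>.\<close>
  define k where "k = nat (int m - n - 1)"
  have k: "nat (int m - n) = Suc k" "nat (int m - (n + 1)) = k" "n + int (Suc k) = int m"
      "n + 1 + int k = int m"
    using False by (simp_all add: k_def)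
  have "Con (trunc C D X T m) n i p = sat_con C D X k (Deg T (int m)) i p"
    using False by (simp add: Con_trunc_less k_def)
  then show ?thesis
    unfolding Deg_trunc k(1,2) unfolding sat_seq_def k(3,4)
    using sat_con_Hom[OF additive ip] by simp
qed

text \<open>Above the cut-off both transition arrows are identities. At \<open>n = m\<close> the
  claim is the factorisation of the connecting homomorphism through \<open>udel\<close>; below, it
  is naturality of \<epsilon>.\<close>

lemma Con_trunc_step:
  assumes ip: "short_exact C i p"
  shows "sat_seq_tr C D X T (n + 1) (Dom C i) (nat (int m - (n + 1))) (nat (int (Suc m) - (n + 1)))
      \<cdot>\<^bsub>D\<^esub> Con (trunc C D X T m) n i p =
    Con (trunc C D X T (Suc m)) n i p \<cdot>\<^bsub>D\<^esub>
      sat_seq_tr C D X T n (Cod C p) (nat (int m - n)) (nat (int (Suc m) - n))"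
proof -
  note A = C.Hom_Ob(1)[OF short_exact_Hom(1)[OF ip]]
    and E = C.Hom_Ob(2)[OF short_exact_Hom(2)[OF ip]]
  note Con_Idn = D.Idn_Cmp[OF Con_Hom[OF ip, of n]] D.Cmp_Idn[OF Con_Hom[OF ip, of n]]
  consider "int m < n" | "int m = n" | "n < int m"
    by linarith
  then show ?thesis
  proof cases
    case 1
    then show ?thesis
      using Con_Idn by (simp add: Con_trunc_ge sat_seq_tr_Idn sat_seq_def)
  next
    case 2
    then have "sat_seq_tr C D X T n (Cod C p) (nat (int m - n)) (nat (int (Suc m) - n)) =
        udel D X T n (Cod C p)"
      using sat_seq_tr_Suc[OF E, of n 0] by (simp add: sat_seq_step_def)
    moreover have "Con (trunc C D X T (Suc m)) n i p = sat_con C D X 0 (Deg T (n + 1)) i p"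
      using 2 by (simp add: Con_trunc_less add.commute)
    ultimately show ?thesis
      using 2 Con_Idn(1) sat_con_udel[OF ip, of n]
      by (simp add: Con_trunc_ge sat_seq_tr_Idn sat_seq_def)
  next
    case 3
    \<comment> \<open>Both transition arrows come from \<open>udel\<close> in degree
      \<open>m\<close>: its \<open>k\<close>-th satellite in degree \<open>n + 1\<close> and its
      next satellite in degree \<open>n\<close>.\<close>
    define k where "k = nat (int m - n - 1)"
    have k: "nat (int m - n) = Suc k" "nat (int (Suc m) - n) = Suc (Suc k)"
        "nat (int m - (n + 1)) = k" "nat (int (Suc m) - (n + 1)) = Suc k"
        "nat (int (Suc m) - n - 1) = Suc k" "n + 1 + int k = int m" "n + int (Suc k) = int m"
      using 3 by (simp_all add: k_def)
    have "Con (trunc C D X T m) n i p = sat_con C D X k (Deg T (int m)) i p"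
      using 3 by (simp add: Con_trunc_less k_def)
    moreover have "Con (trunc C D X T (Suc m)) n i p =
        sat_con C D X k (sat C D X (Deg T (int m + 1))) i p"
      using 3 k(5) by (simp add: Con_trunc_less sat_con_sat add.commute)
    ultimately show ?thesis
      using sat_con_natural[OF additive additive_functor_sat[OF additive] nat_trans_udel ip,
          of k "int m"]
      unfolding k(1-4) sat_seq_tr_Suc[OF A] sat_seq_tr_Suc[OF E] sat_seq_step_def k(6,7) by simp
  qed
qed

text \<open>The one-step squares are pasted by induction on \<open>m'\<close>. With naturality of
  \<open>sat_seq_tr\<close> this yields the existence of \<Phi>.\<close>

lemma Con_trunc_sat_seq_tr:
  assumes ip: "short_exact C i p" and "m \<le> m'"
  shows "sat_seq_tr C D X T (n + 1) (Dom C i) (nat (int m - (n + 1))) (nat (int m' - (n + 1)))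
      \<cdot>\<^bsub>D\<^esub> Con (trunc C D X T m) n i p =
    Con (trunc C D X T m') n i p \<cdot>\<^bsub>D\<^esub>
      sat_seq_tr C D X T n (Cod C p) (nat (int m - n)) (nat (int m' - n))"
  using \<open>m \<le> m'\<close>
proof (induction m' rule: dec_induct)
  case base
  then show ?case
    using D.Idn_Cmp[OF Con_trunc_Hom[OF ip, of m n]] D.Cmp_Idn[OF Con_trunc_Hom[OF ip, of m n]]
    by (simp add: sat_seq_tr_Idn Deg_trunc)
next
  case (step q)
  let ?a = "\<lambda>m. nat (int m - (n + 1))" and ?b = "\<lambda>m. nat (int m - n)"
  let ?tA = "sat_seq_tr C D X T (n + 1) (Dom C i)" and ?tE = "sat_seq_tr C D X T n (Cod C p)"
  let ?Con = "\<lambda>m. Con (trunc C D X T m) n i p"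
  note A = C.Hom_Ob(1)[OF short_exact_Hom(1)[OF ip]]
    and E = C.Hom_Ob(2)[OF short_exact_Hom(2)[OF ip]]
  note Con = Con_trunc_Hom[OF ip, where n = n, unfolded Deg_trunc]
  have a: "?a m \<le> ?a q" "?a q \<le> ?a (Suc q)" and b: "?b m \<le> ?b q" "?b q \<le> ?b (Suc q)"
    using step.hyps by simp_all
  note tA = nat_transD(1)[OF nat_trans_sat_seq_tr A] and tE = nat_transD(1)[OF nat_trans_sat_seq_tr E]
  have "?tA (?a m) (?a (Suc q)) \<cdot>\<^bsub>D\<^esub> ?Con m =
      ?tA (?a q) (?a (Suc q)) \<cdot>\<^bsub>D\<^esub> (?tA (?a m) (?a q) \<cdot>\<^bsub>D\<^esub> ?Con m)"
    using D.Cmp_assoc[OF Con tA[OF a(1)] tA[OF a(2)]] sat_seq_tr_Cmp[OF A a] by simp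
  also have "\<dots> = ?tA (?a q) (?a (Suc q)) \<cdot>\<^bsub>D\<^esub> (?Con q \<cdot>\<^bsub>D\<^esub> ?tE (?b m) (?b q))"
    using step.IH by simp
  also have "\<dots> = (?Con (Suc q) \<cdot>\<^bsub>D\<^esub> ?tE (?b q) (?b (Suc q))) \<cdot>\<^bsub>D\<^esub> ?tE (?b m) (?b q)"
    using D.Cmp_assoc[OF tE[OF b(1)] Con tA[OF a(2)]] Con_trunc_step[OF ip, of n q] by simp
  also have "\<dots> = ?Con (Suc q) \<cdot>\<^bsub>D\<^esub> ?tE (?b m) (?b (Suc q))"
    using D.Cmp_assoc[OF tE[OF b(1)] tE[OF b(2)] Con] sat_seq_tr_Cmp[OF E b] by simp
  finally show ?case .
qed

lemma cohf_morphism_sat_seq_tr: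
  assumes "m \<le> m'"
  shows "cohf_morphism C D (trunc C D X T m) (trunc C D X T m')
    (\<lambda>n M. sat_seq_tr C D X T n M (nat (int m - n)) (nat (int m' - n)))"
  using nat_trans_sat_seq_tr Con_trunc_sat_seq_tr[OF _ assms] assms
  by (simp add: cohf_morphism_def Deg_trunc)

text \<open>Downward induction on the degree from \<open>m'\<close>: in the target, the connecting
  homomorphism of a chosen sequence is the monomorphism \<open>sat_inc\<close>, so the component at
  \<open>M\<close> in degree \<open>n - 1\<close> is determined by the one at the syzygy in degree
  \<open>n\<close>.\<close>

lemma cohf_morphism_unique:
  assumes \<Phi>: "cohf_morphism C D (trunc C D X T m) (trunc C D X T m') \<Phi>"
    and \<Psi>: "cohf_morphism C D (trunc C D X T m) (trunc C D X T m') \<Psi>"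
    and eq: "\<And>n M. int m' \<le> n \<Longrightarrow> M \<in> Ob C \<Longrightarrow> \<Phi> n M = \<Psi> n M"
    and M: "M \<in> Ob C"
  shows "\<Phi> n M = \<Psi> n M"
proof (cases "int m' \<le> n")
  case False
  then have "n \<le> int m'"
    by simp
  then show ?thesis
    using M
  \<comment> \<open>\<open>M\<close> must vary, as the induction step passes to its syzygy.\<close>
  proof (induction n arbitrary: M rule: int_le_induct)
    case base
    then show ?case
      using eq by simp
  next
    case (step n)
    \<comment> \<open>Degree \<open>n - 1\<close> of the target is satellite \<open>k + 1\<close>,
      whose kernel inclusion ends in satellite \<open>k\<close>, that is in degree
      \<open>n\<close>.\<close>
    define k where "k = nat (int m' - n)"
    let ?F = "sat_pow C D X k (Deg T (int m'))"
    note r = resolution[OF step.prems]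
    have Con: "Con (trunc C D X T m') (n - 1) (Pinc X M) (Pepi X M) = sat_inc X ?F M"
      using sat_con_resolution[OF additive step.prems] step.hyps by (simp add: Con_trunc_less k_def)
    have "nat (int m' - (n - 1)) = Suc k" "n - 1 + int (Suc k) = int m'"
      using step.hyps by (simp_all add: k_def)
    then have Obm: "Obm (Deg (trunc C D X T m') (n - 1)) M = sat_obj D X ?F M"
      by (simp add: Deg_trunc sat_seq_def sat_def)
    have "sat_inc X ?F M \<cdot>\<^bsub>D\<^esub> \<Phi> (n - 1) M = sat_inc X ?F M \<cdot>\<^bsub>D\<^esub> \<Psi> (n - 1) M"
    proof -
      have "\<Xi> n (syz C X M) \<cdot>\<^bsub>D\<^esub> Con (trunc C D X T m) (n - 1) (Pinc X M) (Pepi X M) =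
          sat_inc X ?F M \<cdot>\<^bsub>D\<^esub> \<Xi> (n - 1) M"
        if "cohf_morphism C D (trunc C D X T m) (trunc C D X T m') \<Xi>" for \<Xi>
        using that r(1,2) Con unfolding cohf_morphism_def syz_def
        by (metis diff_add_cancel)
      from this[OF \<Phi>] this[OF \<Psi>] show ?thesis
        using step.IH[OF syz_Ob[OF step.prems]] by simp
    qed
    moreover have "\<Phi> (n - 1) M \<in> Hom D (Obm (Deg (trunc C D X T m) (n - 1)) M) (sat_obj D X ?F M)"
        "\<Psi> (n - 1) M \<in> Hom D (Obm (Deg (trunc C D X T m) (n - 1)) M) (sat_obj D X ?F M)"
      using \<Phi> \<Psi> nat_transD(1)[OF _ step.prems] Obm unfolding cohf_morphism_def by metis+
    ultimately show ?case
      using sat_inc_cancel[OF additive_functor_sat_pow[OF additive] step.prems] by blast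
  qed
qed (simp add: eq M)

text \<open>The explicit composites witness the \<open>SOME\<close> in \<open>trunc_map\<close>, and
  uniqueness identifies the selected morphism with them at objects of \<open>C\<close>.\<close>

lemma trunc_map_eq:
  assumes m: "m \<le> m'" and M: "M \<in> Ob C"
  shows "trunc_map C D X T m m' n M = sat_seq_tr C D X T n M (nat (int m - n)) (nat (int m' - n))"
proof -
  have high: "sat_seq_tr C D X T n M (nat (int m - n)) (nat (int m' - n)) = Idn D (Obm (Deg T n) M)"
    if "int m' \<le> n" for n M
    using that m by (simp add: sat_seq_tr_Idn sat_seq_def)
  then have "\<exists>\<Phi>. cohf_morphism C D (trunc C D X T m) (trunc C D X T m') \<Phi> \<and>
      (\<forall>n M. int m' \<le> n \<and> M \<in> Ob C \<longrightarrow> \<Phi> n M = Idn D (Obm (Deg T n) M))"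
    using cohf_morphism_sat_seq_tr[OF m] by blast
  from someI_ex[OF this]
  have "cohf_morphism C D (trunc C D X T m) (trunc C D X T m') (trunc_map C D X T m m')"
    and "int m' \<le> n \<Longrightarrow> M \<in> Ob C \<Longrightarrow> trunc_map C D X T m m' n M = Idn D (Obm (Deg T n) M)" for n M
    unfolding trunc_map_def by blast+
  then show ?thesis
    using cohf_morphism_unique[OF _ cohf_morphism_sat_seq_tr[OF m] _ M] high by simp
qed

section \<open>The limit functor and its description by satellites\<close>

lemma hat_direct_limit:
  assumes M: "M \<in> Ob C"
  shows "is_direct_limit D UNIV (\<le>) (\<lambda>m. Obm (Deg (trunc C D X T m) n) M)
    (\<lambda>m m'. trunc_map C D X T m m' n M) (hat_obj C D X T n M) (hat_leg C D X T n M)"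
proof -
  \<comment> \<open>By \<open>trunc_map_eq\<close> this is the satellite system reindexed along
    \<open>m \<mapsto> nat (int m - n)\<close>, so the laws of a direct system are
    inherited.\<close>
  have "direct_system D UNIV (\<le>) (\<lambda>m. Obm (Deg (trunc C D X T m) n) M)
      (\<lambda>m m'. trunc_map C D X T m m' n M)"
    using sat_seq_Ob[OF M] nat_transD(1)[OF nat_trans_sat_seq_tr M] sat_seq_tr_Idn
      sat_seq_tr_Cmp[OF M]
    by (auto simp: direct_system_def Deg_trunc trunc_map_eq[OF _ M])
  then show ?thesis
    using choices by (simp add: satellite_choices_def hat_obj_def hat_leg_def hat_lim_def)
qed

lemma hat_leg_Hom:
  assumes "M \<in> Ob C"
  shows "hat_leg C D X T n M m \<in>
    Hom D (Obm (sat_seq C D X T n (nat (int m - n))) M) (hat_obj C D X T n M)"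
  using hat_direct_limit[OF assms, of n] by (simp add: is_direct_limit_def cocone_def Deg_trunc)

text \<open>One formula for both branches of \<open>sat_seq_leg\<close>: for \<open>n + k\<close>
  nonnegative the forward arrow is an identity; otherwise \<open>m\<close> is 0 and the arrow ends
  at index \<open>- n\<close>.\<close>

lemma sat_seq_leg_eq:
  assumes M: "M \<in> Ob C" and m: "m = nat (n + int k)"
  shows "k \<le> nat (int m - n)"
    and "sat_seq_leg C D X T n M k =
      hat_leg C D X T n M m \<cdot>\<^bsub>D\<^esub> sat_seq_tr C D X T n M k (nat (int m - n))"
proof -
  show "k \<le> nat (int m - n)"
    using m by auto
  show "sat_seq_leg C D X T n M k =
      hat_leg C D X T n M m \<cdot>\<^bsub>D\<^esub> sat_seq_tr C D X T n M k (nat (int m - n))"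
  proof (cases "0 \<le> n + int k")
    case True
    then have k: "nat (int m - n) = k"
      using m by simp
    have "hat_leg C D X T n M m \<in> Hom D (Obm (sat_seq C D X T n k) M) (hat_obj C D X T n M)"
      using hat_leg_Hom[OF M, of n m] k by simp
    then show ?thesis
      using True D.Cmp_Idn k m by (simp add: sat_seq_leg_def sat_seq_tr_Idn)
  next
    case False
    then show ?thesis
      using m by (simp add: sat_seq_leg_def)
  qed
qed

lemma sat_seq_direct_limit:
  assumes M: "M \<in> Ob C" and J: "{k. 0 \<le> n + int k} \<subseteq> J"
  shows "is_direct_limit D J (\<le>) (\<lambda>k. Obm (sat_seq C D X T n k) M) (sat_seq_tr C D X T n M)
    (hat_obj C D X T n M) (sat_seq_leg C D X T n M)"
proof (rule D.is_direct_limit_cofinal[OF hat_direct_limit[OF M] direct_system_sat_seq[OF M]])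
  show "mono (\<lambda>m. nat (int m - n))"
    by (intro monoI) simp
  \<comment> \<open>\<open>n + nat (int m - n)\<close> is the maximum of \<open>n\<close> and
    \<open>m\<close>, hence nonnegative, so the reindexing stays in \<open>J\<close>.\<close>
  show "nat (int m - n) \<in> J" for m
    using J by auto
  show "\<exists>m. k \<le> nat (int m - n) \<and> sat_seq_leg C D X T n M k =
      hat_leg C D X T n M m \<cdot>\<^bsub>D\<^esub> sat_seq_tr C D X T n M k (nat (int m - n))" for k
    using sat_seq_leg_eq[OF M refl] by blast
qed (simp_all add: trunc_map_eq[OF _ M] Deg_trunc)

lemma direct_system_map_sat_seq:
  assumes f: "f \<in> Hom C M N"
  shows "direct_system_map D J (\<le>) (\<lambda>k. Obm (sat_seq C D X T n k) M) (sat_seq_tr C D X T n M)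
    (\<lambda>k. Obm (sat_seq C D X T n k) N) (sat_seq_tr C D X T n N) (\<lambda>k. Arm (sat_seq C D X T n k) f)"
  using additive_functorD(2)[OF additive_sat_seq f] nat_transD(2)[OF nat_trans_sat_seq_tr f]
  by (simp add: direct_system_map_def)

lemma hat_arr_direct_limit_map:
  assumes f: "f \<in> Hom C M N"
  shows "is_direct_limit_map D UNIV (hat_obj C D X T n M) (hat_leg C D X T n M)
    (hat_obj C D X T n N) (hat_leg C D X T n N) (\<lambda>m. Arm (Deg (trunc C D X T m) n) f)
    (hat_arr C D X T n f)"
proof -
  note M = C.Hom_Ob(1)[OF f] and N = C.Hom_Ob(2)[OF f]
  have "direct_system_map D UNIV (\<le>) (\<lambda>m. Obm (Deg (trunc C D X T m) n) M)
      (\<lambda>m m'. trunc_map C D X T m m' n M) (\<lambda>m. Obm (Deg (trunc C D X T m) n) N)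
      (\<lambda>m m'. trunc_map C D X T m m' n N) (\<lambda>m. Arm (Deg (trunc C D X T m) n) f)"
    using additive_functorD(2)[OF additive_sat_seq f] nat_transD(2)[OF nat_trans_sat_seq_tr f]
    by (simp add: direct_system_map_def Deg_trunc trunc_map_eq[OF _ M] trunc_map_eq[OF _ N])
  moreover have "Dom C f = M" "Cod C f = N"
    using f by (simp_all add: Hom_def)
  ultimately show ?thesis
    using D.the_direct_limit_map[OF hat_direct_limit[OF M] hat_direct_limit[OF N]]
    by (simp add: hat_arr_def)
qed

text \<open>Each leg of the satellite system is a forward transition arrow followed by a leg of the
  limit. Naturality of the transition arrow carries over the equations defining
  \<open>hat_arr\<close>; uniqueness comes from the limit property of the satellite system.\<close>

lemma hat_arr_sat_seq:
  assumes f: "f \<in> Hom C M N" and J: "{k. 0 \<le> n + int k} \<subseteq> J"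
  shows "is_direct_limit_map D J (hat_obj C D X T n M) (sat_seq_leg C D X T n M)
    (hat_obj C D X T n N) (sat_seq_leg C D X T n N) (\<lambda>k. Arm (sat_seq C D X T n k) f)
    (hat_arr C D X T n f)"
proof -
  note M = C.Hom_Ob(1)[OF f] and N = C.Hom_Ob(2)[OF f]
  have w: "hat_arr C D X T n f \<in> Hom D (hat_obj C D X T n M) (hat_obj C D X T n N)"
    and w_leg: "hat_arr C D X T n f \<cdot>\<^bsub>D\<^esub> hat_leg C D X T n M m =
      hat_leg C D X T n N m \<cdot>\<^bsub>D\<^esub> Arm (sat_seq C D X T n (nat (int m - n))) f" for m
    using hat_arr_direct_limit_map[OF f, of n] by (simp_all add: is_direct_limit_map_def Deg_trunc)
  have "hat_arr C D X T n f \<cdot>\<^bsub>D\<^esub> sat_seq_leg C D X T n M k =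
      sat_seq_leg C D X T n N k \<cdot>\<^bsub>D\<^esub> Arm (sat_seq C D X T n k) f" for k
  proof -
    define m where "m = nat (n + int k)"
    note m = sat_seq_leg_eq(1)[OF M m_def]
    note legM = sat_seq_leg_eq(2)[OF M m_def] and legN = sat_seq_leg_eq(2)[OF N m_def]
    let ?l = "nat (int m - n)"
    note tM = nat_transD(1)[OF nat_trans_sat_seq_tr[OF m] M]
      and tN = nat_transD(1)[OF nat_trans_sat_seq_tr[OF m] N]
      and Ff = additive_functorD(2)[OF additive_sat_seq f]
    have "hat_arr C D X T n f \<cdot>\<^bsub>D\<^esub> sat_seq_leg C D X T n M k =
        hat_leg C D X T n N m \<cdot>\<^bsub>D\<^esub> (Arm (sat_seq C D X T n ?l) f \<cdot>\<^bsub>D\<^esub> sat_seq_tr C D X T n M k ?l)"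
      using D.Cmp_assoc[OF tM hat_leg_Hom[OF M] w] D.Cmp_assoc[OF tM Ff hat_leg_Hom[OF N]]
        w_leg legM by simp
    then show ?thesis
      using nat_transD(2)[OF nat_trans_sat_seq_tr[OF m] f] D.Cmp_assoc[OF Ff tN hat_leg_Hom[OF N]]
        legN by simp
  qed
  with w show ?thesis
    by (intro D.direct_limit_mapI[OF sat_seq_direct_limit[OF M J] sat_seq_direct_limit[OF N J]
        direct_system_map_sat_seq[OF f]])
qed

end

text \<open>The two values of \<open>J\<close> are the two readings of the colimit, over all indices
  and over the sufficiently large ones; limit object, legs and induced arrow are shared by
  both.\<close>

theorem theorem3p5:
  fixes C :: "('oc, 'ac) cat" and D :: "('od, 'ad) cat"
    and X :: "('oc, 'ac, 'od, 'ad) choices" and T :: "('oc, 'ac, 'od, 'ad) cohf"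
    and A B :: 'oc and f :: 'ac and n :: int
  assumes "abelian_category C" and "enough_projectives C"
    and "abelian_category D" and "has_exact_direct_limits TYPE('i) D"
    and "satellite_choices C D X"
    and "cohomological_functor C D T"
    and "f \<in> Hom C A B"
  shows "(\<forall>k::nat.
       let F = sat_pow C D X k (Deg T (n + int k));
           G = sat_pow C D X (k + 1) (Deg T (n + int k + 1));
           s = sat_nat_pow C D X k (Deg T (n + int k)) (sat C D X (Deg T (n + int k + 1)))
                 (udel D X T (n + int k))
       in Arm F f \<in> Hom D (Obm F A) (Obm F B) \<and> Arm G f \<in> Hom D (Obm G A) (Obm G B) \<and>
          s A \<in> Hom D (Obm F A) (Obm G A) \<and> s B \<in> Hom D (Obm F B) (Obm G B) \<and>
          s B \<cdot>\<^bsub>D\<^esub> Arm F f = Arm G f \<cdot>\<^bsub>D\<^esub> s A) \<and>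
     (\<forall>J. J = UNIV \<or> J = {k. 0 \<le> n + int k} \<longrightarrow>
       is_direct_limit D J (\<le>) (\<lambda>k. Obm (sat_pow C D X k (Deg T (n + int k))) A)
         (sat_seq_tr C D X T n A) (Obm (hat C D X T n) A) (sat_seq_leg C D X T n A) \<and>
       is_direct_limit D J (\<le>) (\<lambda>k. Obm (sat_pow C D X k (Deg T (n + int k))) B)
         (sat_seq_tr C D X T n B) (Obm (hat C D X T n) B) (sat_seq_leg C D X T n B) \<and>
       is_direct_limit_map D J
         (Obm (hat C D X T n) A) (sat_seq_leg C D X T n A)
         (Obm (hat C D X T n) B) (sat_seq_leg C D X T n B)
         (\<lambda>k. Arm (sat_pow C D X k (Deg T (n + int k))) f) (Arm (hat C D X T n) f))"
proof -
  interpret cohomological_satellites C D X T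
    by (intro cohomological_satellites.intro satellites.intro satellites_axioms.intro
        cohomological_satellites_axioms.intro abelian_category.axioms(1) assms(1,3,5,6))
  note A = C.Hom_Ob(1)[OF assms(7)] and B = C.Hom_Ob(2)[OF assms(7)]
  \<comment> \<open>With the target written as the next term of \<open>sat_seq\<close>, the squares
    are instances of naturality of \<open>sat_seq_step\<close>.\<close>
  have G: "sat_pow C D X (k + 1) (Deg T (n + int k + 1)) = sat_seq C D X T n (Suc k)" for k
    by (simp add: sat_seq_Suc sat_pow_sat)
  show ?thesis
    unfolding Let_def G sat_seq_def[symmetric] sat_seq_step_def[symmetric] hat_def ftor.simps
  proof (intro conjI allI impI)
    fix k
    show "Arm (sat_seq C D X T n k) f \<in>
        Hom D (Obm (sat_seq C D X T n k) A) (Obm (sat_seq C D X T n k) B)"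
      and "Arm (sat_seq C D X T n (Suc k)) f \<in>
        Hom D (Obm (sat_seq C D X T n (Suc k)) A) (Obm (sat_seq C D X T n (Suc k)) B)"
      using additive_functorD(2)[OF additive_sat_seq assms(7)] by blast+
    show "sat_seq_step C D X T n k B \<cdot>\<^bsub>D\<^esub> Arm (sat_seq C D X T n k) f =
        Arm (sat_seq C D X T n (Suc k)) f \<cdot>\<^bsub>D\<^esub> sat_seq_step C D X T n k A"
      using nat_transD(2)[OF nat_trans_sat_seq_step assms(7)] .
  next
    fix J
    assume "J = UNIV \<or> J = {k. 0 \<le> n + int k}"
    then have J: "{k. 0 \<le> n + int k} \<subseteq> J"
      by auto
    show "is_direct_limit_map D J (hat_obj C D X T n A) (sat_seq_leg C D X T n A)
        (hat_obj C D X T n B) (sat_seq_leg C D X T n B) (\<lambda>k. Arm (sat_seq C D X T n k) f)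
        (hat_arr C D X T n f)"
      using hat_arr_sat_seq[OF assms(7) J] .
  qed (use A B sat_seq_step_Hom sat_seq_direct_limit in auto)
qed

end
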